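(* Let $\ell\in\frac12\mathbb{N}$ and let $(\ell_1,\ell_2)\in\frac12\mathbb{N}\times\frac12\mathbb{N}$ satisfy $|\ell_1-\ell_2|\le\ell\le\ell_1+\ell_2$ and $\ell_1+\ell_2-\ell\in\mathbb{Z}$. Let $\varphi=\Phi^{0}_{\frac12,\frac12}$. Then, as functions on $U$, $$\varphi\cdot\Phi^{\ell}_{\ell_1,\ell_2}=\sum_{m_1=|\ell_1-\frac12|}^{\ell_1+\frac12}\ \sum_{m_2=|\ell_2-\frac12|}^{\ell_2+\frac12}\left|a^{(\ell_1,\ell_2)}_{(m_1,m_2),\ell}\right|^2\Phi^{\ell}_{m_1,m_2}$$ (sums in steps of $1$; terms for which $(m_1,m_2)$ does not satisfy $|m_1-m_2|\le\ell\le m_1+m_2$ are understood to be zero), where $$a^{(\ell_1,\ell_2)}_{(m_1,m_2),\ell}=\sum_{j_1,j_2,i_1,i_2,n_1,n_2}C^{\ell_1,\ell_2,\ell}_{j_1,j_2,\ell}\,C^{\frac12,\frac12,0}_{i_1,i_2,0}\,C^{\ell_1,\frac12,m_1}_{j_1,i_1,n_1}\,C^{\ell_2,\frac12,m_2}_{j_2,i_2,n_2}\,C^{m_1,m_2,\ell}_{n_1,n_2,\ell},$$ the sum being over $|j_1|\le\ell_1$, $|j_2|\le\ell_2$, $|i_1|\le\frac12$, $|i_2|\le\frac12$, $|n_1|\le m_1$, $|n_2|\le m_2$ (each index in steps of $1$). Moreover $a^{(\ell_1,\ell_2)}_{(\ell_1+\frac12,\ell_2+\frac12),\ell}\neq 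0$.
   Context: $\mathbb{N}=\{0,1,2,\dots\}$. $K=\mathrm{SU}(2)$, $U=K\times K$, $K_*\subset U$ the diagonal subgroup. For $\ell\in\frac12\mathbb{N}$, $H^\ell=\mathbb{C}[x,y]_{2\ell}$ is the space of homogeneous polynomials of degree $2\ell$ (viewed as functions on $\mathbb{C}^2$), with $K$ acting by $T^\ell(k)p=p\circ k^t$ ($k^t$ the transpose), and inner product for which $\psi^\ell_j=\binom{2\ell}{\ell-j}^{1/2}x^{\ell-j}y^{\ell+j}$, $j=-\ell,-\ell+1,\dots,\ell$, is an orthonormal basis; $T^\ell$ is unitary irreducible. $T^{\ell_1,\ell_2}$ is the outer tensor product representation of $U$ on $H^{\ell_1,\ell_2}=H^{\ell_1}\otimes H^{\ell_2}$. Its restriction to $K_*$ contains $T^\ell$ (then exactly once) iff $|\ell_1-\ell_2|\le\ell\le\ell_1+\ell_2$ and $\ell_1+\ell_2-\ell\in\mathbb{Z}$. $C^{\ell_1,\ell_2,\ell}_{j_1,j_2,j}$ are the (real) Clebsch-Gordan coefficients in the standard normalization (zero unless $j_1+j_2=j$); the linear map $\beta^{\ell_1,\ell_2}_\ell:H^\ell\to H^{\ell_1,\ell_2}$, $\psi^\ell_j\mapsto\sum_{j_1,j_2}C^{\ell_1,\ell_2,\ell}_{j_1,j_2,j}\,\psi^{\ell_1}_{j_1}\otimes\psi^{\ell_2}_{j_2}$, is an isometric $K$-intertwiner. The spherical function of type $\ell$ associated to $(\ell_1,\ell_2)$ is $\Phi^\ell_{\ell_1,\ell_2}:U\to\mathrm{End}(H^\ell)$,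 $\Phi^\ell_{\ell_1,\ell_2}(x)=(\beta^{\ell_1,\ell_2}_\ell)^*\circ T^{\ell_1,\ell_2}(x)\circ\beta^{\ell_1,\ell_2}_\ell$. For $\ell=0$ it is scalar valued. *)

theory Defs
  imports "HOL-Analysis.Analysis"
begin

type_synonym vec2 = "complex^2"
type_synonym mat2 = "complex^2^2"

definition half_nats :: "real set" where
  "half_nats = {real n / 2 | n. True}"

definition steps :: "real \<Rightarrow> real \<Rightarrow> real set" where
  "steps a b = {a + real n | n. a + real n \<le> b}"

text \<open>Used only at real arguments that are natural numbers; half-integer spins and weights are
  kept as reals throughout.\<close>

definition rfact :: "real \<Rightarrow> real" where
  "rfact x = fact (nat \<lfloor>x\<rfloor>)"

definition SU2 :: "mat2 set" where
  "SU2 = {k. k ** (\<chi> i j. cnj (k $ j $ i)) = mat 1 \<and> det k = 1}"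

definition Hspace :: "real \<Rightarrow> (vec2 \<Rightarrow> complex) set" where
  "Hspace l = {p. \<exists>c :: nat \<Rightarrow> complex.
     p = (\<lambda>z. \<Sum>i\<le>nat \<lfloor>2 * l\<rfloor>. c i * (z $ 1) ^ i * (z $ 2) ^ (nat \<lfloor>2 * l\<rfloor> - i))}"

text \<open>This does not mention \<open>l\<close>: the representation on \<open>Hspace l\<close> is its restriction.\<close>

definition Trep :: "mat2 \<Rightarrow> (vec2 \<Rightarrow> complex) \<Rightarrow> (vec2 \<Rightarrow> complex)" where
  "Trep k p = p \<circ> (\<lambda>z. transpose k *v z)"

definition psi :: "real \<Rightarrow> real \<Rightarrow> vec2 \<Rightarrow> complex" where
  "psi l j z = complex_of_real (sqrt (real (nat \<lfloor>2 * l\<rfloor> choose nat \<lfloor>l - j\<rfloor>)))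
     * (z $ 1) ^ nat \<lfloor>l - j\<rfloor> * (z $ 2) ^ nat \<lfloor>l + j\<rfloor>"

text \<open>Coordinates, and the inner product (linear in the first argument) making a linearly
  independent finite family \<open>(e i)\<^sub>i\<^sub>\<in>\<^sub>I\<close> of functions an orthonormal basis of its span.
  Only the values of the coordinates on \<open>I\<close> are determined, and only these are used.\<close>

definition coord :: "'i set \<Rightarrow> ('i \<Rightarrow> 'x \<Rightarrow> complex) \<Rightarrow> ('x \<Rightarrow> complex) \<Rightarrow> 'i \<Rightarrow> complex" where
  "coord I e p = (SOME c. p = (\<lambda>x. \<Sum>i\<in>I. c i * e i x))"

definition basis_inner ::
    "'i set \<Rightarrow> ('i \<Rightarrow> 'x \<Rightarrow> complex) \<Rightarrow> ('x \<Rightarrow> complex) \<Rightarrow> ('x \<Rightarrow> complex) \<Rightarrow> complex" where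
  "basis_inner I e p q = (\<Sum>i\<in>I. coord I e p i * cnj (coord I e q i))"

definition coordH :: "real \<Rightarrow> (vec2 \<Rightarrow> complex) \<Rightarrow> real \<Rightarrow> complex" where
  "coordH l = coord (steps (- l) l) (psi l)"

definition innerH :: "real \<Rightarrow> (vec2 \<Rightarrow> complex) \<Rightarrow> (vec2 \<Rightarrow> complex) \<Rightarrow> complex" where
  "innerH l = basis_inner (steps (- l) l) (psi l)"

text \<open>The tensor product of two spaces of functions on \<open>\<complex>\<^sup>2\<close> is realised as a space of functions
  on \<open>\<complex>\<^sup>2 \<times> \<complex>\<^sup>2\<close>, the pure tensor of \<open>p\<close> and \<open>q\<close> being \<open>(z, w) \<mapsto> p z * q w\<close>.\<close>

definition tensor ::
    "(vec2 \<Rightarrow> complex) \<Rightarrow> (vec2 \<Rightarrow> complex) \<Rightarrow> (vec2 \<times> vec2 \<Rightarrow> complex)"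
    (infixr \<open>\<otimes>\<^sub>f\<close> 75) where
  "p \<otimes>\<^sub>f q = (\<lambda>(z, w). p z * q w)"

definition Hspace2 :: "real \<Rightarrow> real \<Rightarrow> (vec2 \<times> vec2 \<Rightarrow> complex) set" where
  "Hspace2 l1 l2 = {P. \<exists>(n::nat) p q. (\<forall>i<n. p i \<in> Hspace l1 \<and> q i \<in> Hspace l2) \<and>
     P = (\<lambda>x. \<Sum>i<n. (p i \<otimes>\<^sub>f q i) x)}"

definition psi2 :: "real \<Rightarrow> real \<Rightarrow> real \<times> real \<Rightarrow> vec2 \<times> vec2 \<Rightarrow> complex" where
  "psi2 l1 l2 = (\<lambda>(j1, j2). psi l1 j1 \<otimes>\<^sub>f psi l2 j2)"

definition coordH2 ::
    "real \<Rightarrow> real \<Rightarrow> (vec2 \<times> vec2 \<Rightarrow> complex) \<Rightarrow> real \<times> real \<Rightarrow> complex" where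
  "coordH2 l1 l2 = coord (steps (- l1) l1 \<times> steps (- l2) l2) (psi2 l1 l2)"

definition innerH2 :: "real \<Rightarrow> real \<Rightarrow> (vec2 \<times> vec2 \<Rightarrow> complex) \<Rightarrow>
    (vec2 \<times> vec2 \<Rightarrow> complex) \<Rightarrow> complex" where
  "innerH2 l1 l2 = basis_inner (steps (- l1) l1 \<times> steps (- l2) l2) (psi2 l1 l2)"

text \<open>The operator \<open>T k1 \<otimes> T k2\<close>, extended linearly from the basis.\<close>

definition Trep2 :: "real \<Rightarrow> real \<Rightarrow> mat2 \<times> mat2 \<Rightarrow>
    (vec2 \<times> vec2 \<Rightarrow> complex) \<Rightarrow> (vec2 \<times> vec2 \<Rightarrow> complex)" where
  "Trep2 l1 l2 = (\<lambda>(k1, k2) P x. \<Sum>j1\<in>steps (- l1) l1. \<Sum>j2\<in>steps (- l2) l2.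
     coordH2 l1 l2 P (j1, j2) * (Trep k1 (psi l1 j1) \<otimes>\<^sub>f Trep k2 (psi l2 j2)) x)"

text \<open>Clebsch-Gordan coefficients in the Condon-Shortley normalisation, by the formula of
  van der Waerden and Racah; \<open>k\<close> runs over the naturals for which no factorial in the
  denominator has a negative argument. The normalisation fits the basis \<open>psi l\<close>: the
  infinitesimal operator \<open>y \<partial>/\<partial>x\<close> maps \<open>psi l j\<close> to
  \<open>sqrt ((l - j) * (l + j + 1)) * psi l (j + 1)\<close>.\<close>

definition CG :: "real \<Rightarrow> real \<Rightarrow> real \<Rightarrow> real \<Rightarrow> real \<Rightarrow> real \<Rightarrow> real" where
  "CG l1 l2 l j1 j2 j =
    (if \<bar>l1 - l2\<bar> \<le> l \<and> l \<le> l1 + l2 \<and> l1 + l2 - l \<in> \<int> \<and>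
        j1 \<in> steps (- l1) l1 \<and> j2 \<in> steps (- l2) l2 \<and> j \<in> steps (- l) l \<and> j1 + j2 = j
     then
       sqrt ((2 * l + 1) * rfact (l1 + l2 - l) * rfact (l1 - l2 + l) * rfact (- l1 + l2 + l)
             / rfact (l1 + l2 + l + 1)) *
       sqrt (rfact (l1 + j1) * rfact (l1 - j1) * rfact (l2 + j2) * rfact (l2 - j2)
             * rfact (l + j) * rfact (l - j)) *
       (\<Sum>k | real k \<le> l1 + l2 - l \<and> real k \<le> l1 - j1 \<and> real k \<le> l2 + j2 \<and>
              0 \<le> l - l2 + j1 + real k \<and> 0 \<le> l - l1 - j2 + real k.
          (- 1) ^ k / (fact k * rfact (l1 + l2 - l - real k) * rfact (l1 - j1 - real k)
             * rfact (l2 + j2 - real k) * rfact (l - l2 + j1 + real k)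
             * rfact (l - l1 - j2 + real k)))
     else 0)"

definition beta :: "real \<Rightarrow> real \<Rightarrow> real \<Rightarrow> (vec2 \<Rightarrow> complex) \<Rightarrow>
    (vec2 \<times> vec2 \<Rightarrow> complex)" where
  "beta l1 l2 l p = (\<lambda>x. \<Sum>j\<in>steps (- l) l. coordH l p j *
     (\<Sum>j1\<in>steps (- l1) l1. \<Sum>j2\<in>steps (- l2) l2.
        complex_of_real (CG l1 l2 l j1 j2 j) * (psi l1 j1 \<otimes>\<^sub>f psi l2 j2) x))"

definition beta_adj :: "real \<Rightarrow> real \<Rightarrow> real \<Rightarrow> (vec2 \<times> vec2 \<Rightarrow> complex) \<Rightarrow>
    (vec2 \<Rightarrow> complex)" where
  "beta_adj l1 l2 l = restrict (\<lambda>P. THE q. q \<in> Hspace l \<and>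
     (\<forall>p\<in>Hspace l. innerH2 l1 l2 (beta l1 l2 l p) P = innerH l p q)) (Hspace2 l1 l2)"

definition Phi :: "real \<Rightarrow> real \<Rightarrow> real \<Rightarrow> mat2 \<times> mat2 \<Rightarrow>
    (vec2 \<Rightarrow> complex) \<Rightarrow> (vec2 \<Rightarrow> complex)" where
  "Phi l l1 l2 x = beta_adj l1 l2 l \<circ> Trep2 l1 l2 x \<circ> beta l1 l2 l"

text \<open>The identification of \<open>End(H\<^sup>0)\<close> with \<open>\<complex>\<close>.\<close>

definition scalar0 :: "((vec2 \<Rightarrow> complex) \<Rightarrow> (vec2 \<Rightarrow> complex)) \<Rightarrow> complex" where
  "scalar0 A = (THE c. \<forall>p\<in>Hspace 0. A p = (\<lambda>z. c * p z))"

definition phi :: "mat2 \<times> mat2 \<Rightarrow> complex" where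
  "phi x = scalar0 (Phi 0 (1/2) (1/2) x)"

definition acoef :: "real \<Rightarrow> real \<Rightarrow> real \<Rightarrow> real \<Rightarrow> real \<Rightarrow> real" where
  "acoef l1 l2 m1 m2 l =
    (\<Sum>j1\<in>steps (- l1) l1. \<Sum>j2\<in>steps (- l2) l2.
     \<Sum>i1\<in>steps (- (1/2)) (1/2). \<Sum>i2\<in>steps (- (1/2)) (1/2).
     \<Sum>n1\<in>steps (- m1) m1. \<Sum>n2\<in>steps (- m2) m2.
       CG l1 l2 l j1 j2 l * CG (1/2) (1/2) 0 i1 i2 0 * CG l1 (1/2) m1 j1 i1 n1
       * CG l2 (1/2) m2 j2 i2 n2 * CG m1 m2 l n1 n2 l)"

end

theory Submission
  imports Defs
begin

text \<open>
  A product of matrix coefficients of two representations is a matrix coefficient of their tensor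
  product.  Hence \<open>phi * Phi l l1 l2\<close> is the compression of
  \<open>T(l1, l2) \<otimes> T(1/2, 1/2)\<close> to the span of the vectors \<open>beta (psi l j) \<otimes> s\<close>, where \<open>s\<close> is the
  \<open>K\<close>-invariant vector (the singlet) of the second factor.  Splitting each of the products with spin
  \<open>1/2\<close> into irreducible parts (\<open>clebsch_gordan_series_half\<close>) writes the operator as a sum over
  \<open>(m1, m2)\<close>.  The component of \<open>beta p \<otimes> s\<close> in the part \<open>(m1, m2)\<close> depends on \<open>p\<close> through an
  intertwiner from \<open>Hspace l\<close> to the part \<open>(m1, m2)\<close>, and so it is a scalar multiple of \<open>beta m1 m2 l p\<close>
  (\<open>recoupling_proportional\<close>).  The summand is therefore the square of that scalar times
  \<open>Phi l m1 m2\<close>.  The scalar is found by pairing with the image of the highest weight vector, which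
  has norm one (\<open>cg_top_weight_norm\<close>), and this pairing is \<open>acoef\<close>.

  Instead of Schur's lemma, the proof of proportionality is a computation with invariant polynomials.
  For spins with \<open>2 l1 = A + N\<close>, \<open>2 l2 = B + N\<close>, \<open>2 l = A + B\<close> the coupling coefficients
  have the generating function
    \<open>\<Sum> C psi(z) psi(w) psi(u) = kappa * [z, w]\<^sup>N * (z \<bullet> u)\<^sup>A * (w \<bullet> u)\<^sup>B\<close>,
  where \<open>[z, w] = z2 * w1 - z1 * w2\<close> and \<open>z \<bullet> u = z1 * u1 + z2 * u2\<close>
  (\<open>racah_generating_function\<close>).  Equivariance under matrices of determinant one can be read off from
  the right-hand side.  Tensoring with the singlet and projecting onto \<open>(m1, m2)\<close> acts on this
  polynomial, up to a constant, as one of four invariant operators: multiplication by \<open>[z, w]\<close> if both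
  spins go up, a polarisation \<open>z \<bullet> \<partial>\<^sub>w\<close> or \<open>w \<bullet> \<partial>\<^sub>z\<close> if one goes up and one goes down, and Cayley's
  operator \<open>\<partial>\<^sub>z\<^sub>2 \<partial>\<^sub>w\<^sub>1 - \<partial>\<^sub>z\<^sub>1 \<partial>\<^sub>w\<^sub>2\<close> if both go down.  Each of them sends
  \<open>[z, w]\<^sup>N * (z \<bullet> u)\<^sup>A * (w \<bullet> u)\<^sup>B\<close> to a multiple of the same expression with shifted
  exponents.  Multiplication by \<open>[z, w]\<close> kills nothing, which gives the nonvanishing of the leading
  coefficient.
\<close>

section \<open>Rearranging finite sums\<close>

lemma sum_product3:
  fixes f g h :: "nat \<Rightarrow> complex"
  shows "(\<Sum>k\<in>A. f k) * (\<Sum>s\<in>B. g s) * (\<Sum>t\<in>C. h t) =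
    (\<Sum>(k, s, t)\<in>A \<times> B \<times> C. f k * g s * h t)"
  by (simp flip: sum.cartesian_product sum_distrib_left sum_distrib_right)

lemma sum_pair: "(\<Sum>x\<in>X. \<Sum>y\<in>Y. g x y) = (\<Sum>p\<in>X \<times> Y. g (fst p) (snd p))"
  by (simp add: sum.cartesian_product split_def)

lemma sum_pairs:
  "(\<Sum>a\<in>A. \<Sum>b\<in>B. \<Sum>c\<in>C. \<Sum>d\<in>D. F a b c d) =
   (\<Sum>p\<in>A \<times> B. \<Sum>q\<in>C \<times> D. F (fst p) (snd p) (fst q) (snd q))"
  by (rule trans[OF sum_pair], rule sum.cong[OF refl], rule sum_pair)

lemma sum_swap_pairs:
  "(\<Sum>b1\<in>A. \<Sum>b2\<in>B. \<Sum>a1\<in>C. \<Sum>a2\<in>D. F b1 b2 a1 a2) =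
   (\<Sum>a1\<in>C. \<Sum>a2\<in>D. \<Sum>b1\<in>A. \<Sum>b2\<in>B. F b1 b2 a1 a2)"
  unfolding sum_pairs by (rule sum.swap)

lemma sum_pull2:
  "(\<Sum>b\<in>B. \<Sum>j\<in>J. \<Sum>y\<in>Y. F b j y) = (\<Sum>y\<in>Y. \<Sum>b\<in>B. \<Sum>j\<in>J. F b j y)"
proof -
  have "(\<Sum>b\<in>B. \<Sum>j\<in>J. \<Sum>y\<in>Y. F b j y) = (\<Sum>b\<in>B. \<Sum>y\<in>Y. \<Sum>j\<in>J. F b j y)"
    by (rule sum.cong[OF refl], rule sum.swap)
  also have "\<dots> = (\<Sum>y\<in>Y. \<Sum>b\<in>B. \<Sum>j\<in>J. F b j y)" by (rule sum.swap)
  finally show ?thesis .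
qed

lemma sum_product_double:
  fixes f :: "'a \<Rightarrow> 'b \<Rightarrow> complex"
  shows "(\<Sum>a\<in>A. \<Sum>b\<in>B. f a b) * (\<Sum>c\<in>C. \<Sum>d\<in>D. g c d) =
    (\<Sum>a\<in>A. \<Sum>b\<in>B. \<Sum>c\<in>C. \<Sum>d\<in>D. f a b * g c d)"
  by (simp only: sum_distrib_left [symmetric] sum_distrib_right [symmetric])

lemma sum_bilinear_expansion:
  fixes R :: "'y \<Rightarrow> complex"
  shows "(\<Sum>a\<in>A. \<Sum>i\<in>I. \<Sum>b\<in>B. \<Sum>j\<in>J. \<Sum>y\<in>Y. R y * (P y a i * Q y b j)) =
    (\<Sum>y\<in>Y. R y * ((\<Sum>a\<in>A. \<Sum>i\<in>I. P y a i) * (\<Sum>b\<in>B. \<Sum>j\<in>J. Q y b j)))"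
proof -
  have "(\<Sum>a\<in>A. \<Sum>i\<in>I. \<Sum>b\<in>B. \<Sum>j\<in>J. \<Sum>y\<in>Y. R y * (P y a i * Q y b j)) =
      (\<Sum>a\<in>A. \<Sum>i\<in>I. \<Sum>y\<in>Y. \<Sum>b\<in>B. \<Sum>j\<in>J. R y * (P y a i * Q y b j))"
    by (rule sum.cong[OF refl], rule sum.cong[OF refl], rule sum_pull2)
  also have "\<dots> = (\<Sum>y\<in>Y. \<Sum>a\<in>A. \<Sum>i\<in>I. \<Sum>b\<in>B. \<Sum>j\<in>J. R y * (P y a i * Q y b j))"
    by (rule sum_pull2)
  also have "\<dots> = (\<Sum>y\<in>Y. R y * ((\<Sum>a\<in>A. \<Sum>i\<in>I. P y a i) * (\<Sum>b\<in>B. \<Sum>j\<in>J. Q y b j)))"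
    by (simp only: sum_distrib_left [symmetric] sum_distrib_right [symmetric])
  finally show ?thesis .
qed

lemma sum_single:
  fixes f :: "nat \<Rightarrow> complex"
  assumes "m \<le> A"
  shows "(\<Sum>n\<le>A. of_real (if n = m then r else 0) * f n) = of_real r * f m"
  using assms by (subst sum.remove[of _ m]) (auto intro!: sum.neutral)

lemma sum_indicator_mult:
  fixes f :: "nat \<Rightarrow> complex"
  assumes "i \<le> L"
  shows "(\<Sum>a\<le>L. (if a = i then 1 else 0) * f a) = f i"
proof -
  have "(\<Sum>a\<le>L. (if a = i then 1 else 0) * f a) = (\<Sum>a\<le>L. if a = i then f a else 0)"
    by (rule sum.cong[OF refl]) simp
  then show ?thesis using assms by simp
qed

section \<open>Weight vectors and coupling coefficients indexed by natural numbers\<close>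

text \<open>The function \<open>psi (L/2) (L/2 - a)\<close> on coordinates: \<open>L\<close> is twice the spin, and \<open>a = l - j\<close> is the
  exponent of the first coordinate, so that the highest weight has \<open>a = 0\<close>.\<close>

definition pol :: "nat \<Rightarrow> nat \<Rightarrow> complex \<Rightarrow> complex \<Rightarrow> complex" where
  "pol L a x y = complex_of_real (sqrt (real (L choose a))) * x ^ a * y ^ (L - a)"

definition cg :: "nat \<Rightarrow> nat \<Rightarrow> nat \<Rightarrow> nat \<Rightarrow> nat \<Rightarrow> nat \<Rightarrow> real" where
  "cg L1 L2 L a1 a2 a = CG (real L1 / 2) (real L2 / 2) (real L / 2)
     (real L1 / 2 - real a1) (real L2 / 2 - real a2) (real L / 2 - real a)"

lemma steps_spin:
  "steps (- (real L / 2)) (real L / 2) = (\<lambda>a. real L / 2 - real a) ` {..L}"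
proof -
  have rev: "{..L} = (\<lambda>a. L - a) ` {..L}"
  proof (intro equalityI subsetI)
    fix x assume "x \<in> {..L}"
    then show "x \<in> (\<lambda>a. L - a) ` {..L}" by (intro image_eqI[where x = "L - x"]) auto
  qed auto
  have "steps (- (real L / 2)) (real L / 2) = (\<lambda>b. - (real L / 2) + real b) ` {..L}"
    by (auto simp: steps_def)
  also have "\<dots> = (\<lambda>a. real L / 2 - real a) ` {..L}"
    by (subst rev, unfold image_image, intro image_cong) (auto simp: of_nat_diff)
  finally show ?thesis .
qed

lemma sum_spin:
  "(\<Sum>j\<in>steps (- (real L / 2)) (real L / 2). f j) = (\<Sum>a\<le>L. f (real L / 2 - real a))"
  unfolding steps_spin by (subst sum.reindex) (auto simp: inj_on_def)

lemma psi_spin: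
  "a \<le> L \<Longrightarrow> psi (real L / 2) (real L / 2 - real a) z = pol L a (z $ 1) (z $ 2)"
proof -
  assume a: "a \<le> L"
  then have "real L / 2 + (real L / 2 - real a) = real (L - a)" by (simp add: of_nat_diff)
  then show ?thesis by (simp add: psi_def pol_def del: of_nat_diff)
qed

lemma pol_eq_iff:
  assumes "\<And>x y. (\<Sum>a\<le>L. c a * pol L a x y) = (\<Sum>a\<le>L. d a * pol L a x y)" and "a \<le> L"
  shows "c a = d a"
proof -
  let ?s = "\<lambda>a. complex_of_real (sqrt (real (L choose a)))"
  have "(\<Sum>a\<le>L. (c a * ?s a) * x ^ a) = (\<Sum>a\<le>L. (d a * ?s a) * x ^ a)" for x
    using assms(1)[of x 1] by (simp add: pol_def mult.assoc)
  then have "c a * ?s a = d a * ?s a"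
    using polyfun_eq_coeffs[where n = L and c = "\<lambda>a. c a * ?s a" and d = "\<lambda>a. d a * ?s a"] assms(2) by auto
  then show ?thesis using assms(2) by simp
qed

lemma of_real_sqrt_square:
  "complex_of_real (sqrt (real n)) * (complex_of_real (sqrt (real n)) * z) = of_nat n * z"
proof -
  have "complex_of_real (sqrt (real n)) * complex_of_real (sqrt (real n)) = of_nat n"
    unfolding of_real_mult [symmetric] by simp
  then show ?thesis by (simp flip: mult.assoc)
qed

text \<open>The kernel is what makes the functions \<open>pol L a\<close> self-dual: multiplying by \<open>pol L a u v\<close> and
  summing over \<open>a\<close> turns statements about all weights into polynomial identities in \<open>(u, v)\<close>.\<close>

lemma pol_kernel:
  "(\<Sum>a\<le>L. pol L a x y * pol L a u v) = (x * u + y * v) ^ L"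
  unfolding binomial_ring
  by (intro sum.cong refl)
    (simp add: pol_def power_mult_distrib mult.assoc mult.left_commute of_real_sqrt_square)

text \<open>Triples of spins that can be coupled are parametrised by \<open>A = l1 - l2 + l\<close>, \<open>B = l2 - l1 + l\<close> and
  \<open>N = l1 + l2 - l\<close>.  In these terms all arguments of factorials are differences of naturals.\<close>

lemma cg_racah:
  assumes "a1 \<le> A + N" "a2 \<le> B + N" "a \<le> A + B"
  shows "cg (A + N) (B + N) (A + B) a1 a2 a =
    (if a1 + a2 = N + a then
       sqrt (real (A + B + 1) * fact N * fact A * fact B / fact (A + B + N + 1)) *
       sqrt (fact (A + N - a1) * fact a1 * fact (B + N - a2) * fact a2 * fact (A + B - a) * fact a) *
       (\<Sum>k | k \<le> N \<and> k \<le> a1 \<and> k + a2 \<le> B + N \<and> a1 \<le> A + k \<and> N \<le> a2 + k.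
          (- 1) ^ k / (fact k * fact (N - k) * fact (a1 - k) * fact (B + N - a2 - k) *
            fact (A + k - a1) * fact (a2 + k - N)))
     else 0)"
proof -
  define l1 l2 l where "l1 = real (A + N) / 2" "l2 = real (B + N) / 2" "l = real (A + B) / 2"
  have e: "l1 + l2 - l = real N" "l1 - l2 + l = real A" "- l1 + l2 + l = real B"
    "l1 + l2 + l + 1 = real (A + B + N + 1)" "2 * l + 1 = real (A + B + 1)"
    by (auto simp: l1_l2_l_def field_simps)
  have mem: "real L / 2 - real b \<in> steps (- (real L / 2)) (real L / 2)" if "b \<le> L" for L b
    using that by (auto simp: steps_spin)
  have adm: "\<bar>l1 - l2\<bar> \<le> l \<and> l \<le> l1 + l2" using e(1-3) by linarith
  have w: "l1 - a1 + (l2 - a2) = l - a \<longleftrightarrow> a1 + a2 = N + a"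
  proof -
    have "l1 - a1 + (l2 - a2) = l - a \<longleftrightarrow> real (a1 + a2) = real (N + a)"
      using e(1) by (simp only: of_nat_add) linarith
    then show ?thesis by (simp only: of_nat_eq_iff)
  qed
  show ?thesis
  proof (cases "a1 + a2 = N + a")
    case False
    then show ?thesis using w by (simp add: cg_def CG_def l1_l2_l_def)
  next
    case True
    have r: "rfact (real n) = fact n" for n by (simp add: rfact_def)
    have f: "l1 + (l1 - a1) = real (A + N - a1)" "l1 - (l1 - a1) = real a1"
       "l2 + (l2 - a2) = real (B + N - a2)" "l2 - (l2 - a2) = real a2"
       "l + (l - a) = real (A + B - a)" "l - (l - a) = real a"
      using assms by (auto simp: l1_l2_l_def of_nat_diff field_simps)
    have g: "l - l2 + (l1 - a1) = real A - real a1" "l - l1 - (l2 - a2) = real a2 - real N"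
      by (auto simp: l1_l2_l_def field_simps)
    let ?K = "{k. k \<le> N \<and> k \<le> a1 \<and> k + a2 \<le> B + N \<and> a1 \<le> A + k \<and> N \<le> a2 + k}"
    have K: "{k. real k \<le> real N \<and> real k \<le> real a1 \<and> real k \<le> real (B + N - a2) \<and>
        0 \<le> real A - real a1 + real k \<and> 0 \<le> real a2 - real N + real k} = ?K"
      using assms by auto
    have S: "(\<Sum>k | real k \<le> real N \<and> real k \<le> real a1 \<and> real k \<le> real (B + N - a2) \<and>
        0 \<le> real A - real a1 + real k \<and> 0 \<le> real a2 - real N + real k.
        (- 1) ^ k / (fact k * rfact (real N - real k) * rfact (real a1 - real k)
             * rfact (real (B + N - a2) - real k) * rfact (real A - real a1 + real k)
             * rfact (real a2 - real N + real k))) = 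
        (\<Sum>k\<in>?K. (- 1) ^ k / (fact k * fact (N - k) * fact (a1 - k) * fact (B + N - a2 - k) *
            fact (A + k - a1) * fact (a2 + k - N)))"
      unfolding K
    proof (intro sum.cong refl)
      fix k assume k: "k \<in> ?K"
      then have "real N - real k = real (N - k)" "real a1 - real k = real (a1 - k)"
        "real (B + N - a2) - real k = real (B + N - a2 - k)"
        "real A - real a1 + real k = real (A + k - a1)"
        "real a2 - real N + real k = real (a2 + k - N)"
        using assms by (auto simp: of_nat_diff)
      then show "(- 1) ^ k / (fact k * rfact (real N - real k) * rfact (real a1 - real k)
             * rfact (real (B + N - a2) - real k) * rfact (real A - real a1 + real k)
             * rfact (real a2 - real N + real k)) =
            (- 1) ^ k / (fact k * fact (N - k) * fact (a1 - k) * fact (B + N - a2 - k) *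
            fact (A + k - a1) * fact (a2 + k - N))" by (simp only: r)
    qed
    have c: "cg (A + N) (B + N) (A + B) a1 a2 a = CG l1 l2 l (l1 - a1) (l2 - a2) (l - a)"
      by (simp add: cg_def l1_l2_l_def)
    have c': "\<bar>l1 - l2\<bar> \<le> l \<and> l \<le> l1 + l2 \<and> l1 + l2 - l \<in> \<int> \<and>
        l1 - a1 \<in> steps (- l1) l1 \<and> l2 - a2 \<in> steps (- l2) l2 \<and> l - a \<in> steps (- l) l \<and>
        l1 - a1 + (l2 - a2) = l - a"
    proof -
      have "l1 - a1 \<in> steps (- l1) l1" "l2 - a2 \<in> steps (- l2) l2" "l - a \<in> steps (- l) l"
        unfolding l1_l2_l_def using assms by (intro mem, simp)+
      then show ?thesis using adm e(1) w True by auto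
    qed
    show ?thesis
      unfolding c CG_def e f g r S if_P[OF c'[unfolded e]] if_P[OF True] ..
  qed
qed

section \<open>The generating function of the coupling coefficients\<close>

text \<open>The constant that remains when the binomial normalisations of the three families \<open>pol\<close> are combined
  with the square roots in the formula of Racah.\<close>

definition kappa :: "nat \<Rightarrow> nat \<Rightarrow> nat \<Rightarrow> real" where
  "kappa A B N = sqrt (real (A + B + 1) * fact N * fact A * fact B / fact (A + B + N + 1) *
      (fact (A + N) * fact (B + N) * fact (A + B))) / (fact N * fact A * fact B)"

lemma kappa_pos: "kappa A B N > 0"
  by (simp add: kappa_def)

text \<open>The factorials that depend on the weights cancel against the binomial normalisations of \<open>pol\<close>.\<close>

lemma racah_scalar:
  assumes "a1 \<le> A + N" "a2 \<le> B + N" "a \<le> A + B"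
  shows "sqrt (real (A + B + 1) * fact N * fact A * fact B / fact (A + B + N + 1)) *
       sqrt (fact (A + N - a1) * fact a1 * fact (B + N - a2) * fact a2 * fact (A + B - a) * fact a) *
       (sqrt (real ((A + N) choose a1)) * sqrt (real ((B + N) choose a2)) * sqrt (real ((A + B) choose a)))
     = kappa A B N * (fact N * fact A * fact B)"
proof -
  have "fact (A + N - a1) * fact a1 * fact (B + N - a2) * fact a2 * fact (A + B - a) * fact a *
      (real ((A + N) choose a1) * real ((B + N) choose a2) * real ((A + B) choose a)) =
      (fact (A + N) * fact (B + N) * fact (A + B) :: real)"
    using assms by (simp add: binomial_fact field_simps)
  then have h: "sqrt (fact (A + N - a1) * fact a1 * fact (B + N - a2) * fact a2 * fact (A + B - a) * fact a) *
       (sqrt (real ((A + N) choose a1)) * sqrt (real ((B + N) choose a2)) * sqrt (real ((A + B) choose a)))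
     = sqrt (fact (A + N) * fact (B + N) * fact (A + B))"
    by (simp only: real_sqrt_mult [symmetric])
  have cancel: "x / y * y = x" if "y \<noteq> 0" for x y :: real
    using that by simp
  have "kappa A B N * (fact N * fact A * fact B) =
      sqrt (real (A + B + 1) * fact N * fact A * fact B / fact (A + B + N + 1) *
        (fact (A + N) * fact (B + N) * fact (A + B)))"
    unfolding kappa_def by (rule cancel) simp
  then show ?thesis
    unfolding real_sqrt_mult [of _ "fact (A + N) * fact (B + N) * fact (A + B)"] h [symmetric]
    by (simp only: mult.assoc)
qed

text \<open>Expanding the three powers on the right by the binomial theorem with summation indices \<open>k\<close>, \<open>s\<close>,
  \<open>t\<close>, the exponents of \<open>z1\<close>, \<open>w1\<close>, \<open>u1\<close> are \<open>a1 = k + s\<close>, \<open>a2 = N - k + t\<close>, \<open>a = s + t\<close>.  For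
  given \<open>a1\<close>, \<open>a2\<close>, \<open>a\<close> the free index \<open>k\<close> is the summation index of Racah's formula.\<close>

lemma racah_generating_function:
  "(\<Sum>a1\<le>A + N. \<Sum>a2\<le>B + N. \<Sum>a\<le>A + B. of_real (cg (A + N) (B + N) (A + B) a1 a2 a) *
      (pol (A + N) a1 z1 z2 * pol (B + N) a2 w1 w2 * pol (A + B) a u1 u2)) =
   of_real (kappa A B N) *
     ((z2 * w1 - z1 * w2) ^ N * (z1 * u1 + z2 * u2) ^ A * (w1 * u1 + w2 * u2) ^ B)"
proof -
  define K where "K a1 a2 = {k. k \<le> N \<and> k \<le> a1 \<and> k + a2 \<le> B + N \<and> a1 \<le> A + k \<and> N \<le> a2 + k}" for a1 a2
  \<comment> \<open>The contribution of one value of Racah's summation index, apart from \<open>kappa A B N\<close>, to the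
      coefficient of the monomial \<open>X a1 a2 a\<close>.\<close>
  define T :: "nat \<Rightarrow> nat \<Rightarrow> nat \<Rightarrow> nat \<Rightarrow> real" where
    "T a1 a2 a k = (- 1) ^ k * (fact N * fact A * fact B) / (fact k * fact (N - k) * fact (a1 - k) * fact (B + N - a2 - k) *
            fact (A + k - a1) * fact (a2 + k - N))" for a1 a2 a k
  define X where "X a1 a2 a = z1 ^ a1 * z2 ^ (A + N - a1) * (w1 ^ a2 * w2 ^ (B + N - a2)) *
      (u1 ^ a * u2 ^ (A + B - a))" for a1 a2 a
  define S where "S = {(a1, a2, a, k). a1 \<le> A + N \<and> a2 \<le> B + N \<and> a \<le> A + B \<and> a1 + a2 = N + a \<and> k \<in> K a1 a2}"
  have summand: "of_real (cg (A + N) (B + N) (A + B) a1 a2 a) *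
      (pol (A + N) a1 z1 z2 * pol (B + N) a2 w1 w2 * pol (A + B) a u1 u2) =
      (\<Sum>k\<le>N. if a1 + a2 = N + a \<and> k \<in> K a1 a2 then of_real (kappa A B N) * (of_real (T a1 a2 a k) * X a1 a2 a) else 0)"
    if a: "a1 \<le> A + N" "a2 \<le> B + N" "a \<le> A + B" for a1 a2 a
  proof (cases "a1 + a2 = N + a")
    case True
    let ?b = "sqrt (real ((A + N) choose a1)) * sqrt (real ((B + N) choose a2)) * sqrt (real ((A + B) choose a))"
    let ?R = "\<Sum>k\<in>K a1 a2. (- 1) ^ k / (fact k * fact (N - k) * fact (a1 - k) * fact (B + N - a2 - k) *
            fact (A + k - a1) * fact (a2 + k - N))"
    have "cg (A + N) (B + N) (A + B) a1 a2 a * ?b = 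
       (sqrt (real (A + B + 1) * fact N * fact A * fact B / fact (A + B + N + 1)) *
       sqrt (fact (A + N - a1) * fact a1 * fact (B + N - a2) * fact a2 * fact (A + B - a) * fact a) * ?b) * ?R"
      unfolding cg_racah[OF a] if_P[OF True] K_def by (simp only: mult.assoc mult.commute mult.left_commute)
    also have "\<dots> = (\<Sum>k\<in>K a1 a2. kappa A B N * T a1 a2 a k)"
      unfolding racah_scalar[OF a] by (simp add: sum_distrib_left T_def mult_ac)
    also have "\<dots> = (\<Sum>k\<le>N. if k \<in> K a1 a2 then kappa A B N * T a1 a2 a k else 0)"
      by (rule sum.mono_neutral_cong_left) (auto simp: K_def)
    finally have e: "cg (A + N) (B + N) (A + B) a1 a2 a * ?b = \<dots>" .
    have "of_real (cg (A + N) (B + N) (A + B) a1 a2 a) *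
      (pol (A + N) a1 z1 z2 * pol (B + N) a2 w1 w2 * pol (A + B) a u1 u2) =
      of_real (cg (A + N) (B + N) (A + B) a1 a2 a * ?b) * X a1 a2 a"
      by (simp add: pol_def X_def mult_ac)
    also have "\<dots> = (\<Sum>k\<le>N. if k \<in> K a1 a2 then of_real (kappa A B N) * (of_real (T a1 a2 a k) * X a1 a2 a) else 0)"
      unfolding e of_real_sum sum_distrib_right by (intro sum.cong) (auto simp: mult_ac)
    finally show ?thesis using True by simp
  qed (simp add: cg_racah[OF a])
  have "(\<Sum>a1\<le>A + N. \<Sum>a2\<le>B + N. \<Sum>a\<le>A + B. of_real (cg (A + N) (B + N) (A + B) a1 a2 a) *
      (pol (A + N) a1 z1 z2 * pol (B + N) a2 w1 w2 * pol (A + B) a u1 u2)) =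
    (\<Sum>a1\<le>A + N. \<Sum>a2\<le>B + N. \<Sum>a\<le>A + B. \<Sum>k\<le>N.
       if a1 + a2 = N + a \<and> k \<in> K a1 a2 then of_real (kappa A B N) * (of_real (T a1 a2 a k) * X a1 a2 a) else 0)"
    by (intro sum.cong refl summand) auto
  also have "\<dots> = (\<Sum>(a1, a2, a, k)\<in>{..A + N} \<times> {..B + N} \<times> {..A + B} \<times> {..N}.
       if a1 + a2 = N + a \<and> k \<in> K a1 a2 then of_real (kappa A B N) * (of_real (T a1 a2 a k) * X a1 a2 a) else 0)"
    by (simp only: sum.cartesian_product split_def fst_conv snd_conv)
  also have "\<dots> = (\<Sum>(a1, a2, a, k)\<in>S. of_real (kappa A B N) * (of_real (T a1 a2 a k) * X a1 a2 a))"
    by (rule sum.mono_neutral_cong_right) (auto simp: S_def K_def split: if_splits)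
  also have "\<dots> = (\<Sum>(k, s, t)\<in>{..N} \<times> {..A} \<times> {..B}. of_real (kappa A B N) *
       ((of_nat (N choose k) * (- (z1 * w2)) ^ k * (z2 * w1) ^ (N - k)) *
        (of_nat (A choose s) * (z1 * u1) ^ s * (z2 * u2) ^ (A - s)) *
        (of_nat (B choose t) * (w1 * u1) ^ t * (w2 * u2) ^ (B - t))))"
  proof (rule sum.reindex_bij_witness[of _ "\<lambda>(k, s, t). (k + s, N - k + t, s + t, k)"
        "\<lambda>(a1, a2, a, k). (k, a1 - k, a2 + k - N)"], goal_cases)
    case (5 q)
    obtain a1 a2 a k where q: "q = (a1, a2, a, k)" by (cases q)
    define s t where "s = a1 - k" "t = a2 + k - N"
    have h: "a1 = k + s" "a2 = N - k + t" "a = s + t" "k \<le> N" "s \<le> A" "t \<le> B" "a2 + k = N + t"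
      using 5 by (auto simp: q S_def K_def s_t_def)
    have i: "B + N - a2 - k = B - t" "A + k - a1 = A - s" "a2 + k - N = t" "a1 - k = s"
      "A + N - a1 = (N - k) + (A - s)" "B + N - a2 = k + (B - t)" "A + B - a = (A - s) + (B - t)"
      using h by auto
    have "T a1 a2 a k = (-1) ^ k * (real (N choose k) * real (A choose s) * real (B choose t))"
      unfolding T_def i using h(4-6) by (simp add: binomial_fact)
    moreover have "(- (z1 * w2)) ^ k = (-1) ^ k * (z1 ^ k * w2 ^ k)"
      by (metis mult_minus1 power_mult_distrib)
    moreover have "X a1 a2 a = z1 ^ k * z1 ^ s * (z2 ^ (N - k) * z2 ^ (A - s)) *
       (w1 ^ (N - k) * w1 ^ t * (w2 ^ k * w2 ^ (B - t))) * (u1 ^ s * u1 ^ t * (u2 ^ (A - s) * u2 ^ (B - t)))"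
      unfolding X_def i by (simp only: h(1-3) power_add)
    ultimately show ?case
      by (simp add: q i power_mult_distrib mult_ac)
  qed (auto simp: S_def K_def)
  also have "\<dots> = of_real (kappa A B N) * ((\<Sum>k\<le>N. of_nat (N choose k) * (- (z1 * w2)) ^ k * (z2 * w1) ^ (N - k)) *
     (\<Sum>s\<le>A. of_nat (A choose s) * (z1 * u1) ^ s * (z2 * u2) ^ (A - s)) *
     (\<Sum>t\<le>B. of_nat (B choose t) * (w1 * u1) ^ t * (w2 * u2) ^ (B - t)))"
    unfolding sum_distrib_left [symmetric] sum_product3 by (simp add: split_def flip: sum_distrib_left)
  also have "\<dots> = of_real (kappa A B N) *
     ((z2 * w1 - z1 * w2) ^ N * (z1 * u1 + z2 * u2) ^ A * (w1 * u1 + w2 * u2) ^ B)"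
    unfolding binomial_ring [symmetric] by (simp add: algebra_simps)
  finally show ?thesis .
qed

section \<open>Normalisation at the highest weight\<close>

text \<open>Vandermonde's convolution for the negative upper arguments \<open>- (B + 1)\<close> and \<open>- (A + 1)\<close>.\<close>

lemma vandermonde_hockey_stick:
  "(\<Sum>k\<le>N. ((A + N - k) choose (N - k)) * ((B + k) choose k)) = (A + B + N + 1) choose N"
proof -
  have neg: "(- real (A + 1)) gchoose k = (- 1) ^ k * real ((A + k) choose k)" for A k
    by (subst gbinomial_minus) (simp add: binomial_gbinomial add_ac)
  have s: "- real (B + 1) + - real (A + 1) = - real (A + B + 1 + 1)" by simp
  have "(\<Sum>k\<le>N. ((- real (B + 1)) gchoose k) * ((- real (A + 1)) gchoose (N - k))) =
      (- real (A + B + 1 + 1)) gchoose N"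
    using gbinomial_Vandermonde[of "- real (B + 1)" "- real (A + 1)" N]
    by (simp only: atMost_atLeast0 s)
  also have "\<dots> = (- 1) ^ N * real ((A + B + N + 1) choose N)"
    unfolding neg by (simp add: algebra_simps)
  also have "(\<Sum>k\<le>N. ((- real (B + 1)) gchoose k) * ((- real (A + 1)) gchoose (N - k))) =
     (\<Sum>k\<le>N. (- 1) ^ N * (real ((A + N - k) choose (N - k)) * real ((B + k) choose k)))"
    unfolding neg
  proof (intro sum.cong refl)
    fix k assume "k \<in> {..N}"
    then have "(- 1 :: real) ^ N = (- 1) ^ k * (- 1) ^ (N - k)" "A + (N - k) = A + N - k"
      by (auto simp flip: power_add)
    then show "(- 1) ^ k * real (B + k choose k) * ((- 1) ^ (N - k) * real (A + (N - k) choose (N - k))) =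
       (- 1) ^ N * (real ((A + N - k) choose (N - k)) * real ((B + k) choose k))" by simp
  qed
  finally have "(\<Sum>k\<le>N. real ((A + N - k) choose (N - k)) * real ((B + k) choose k)) =
     real ((A + B + N + 1) choose N)"
    by (simp flip: sum_distrib_left)
  then show ?thesis by (simp only: of_nat_mult [symmetric] of_nat_sum [symmetric] of_nat_eq_iff)
qed

text \<open>At the highest weight \<open>a = 0\<close> the conditions on Racah's summation index leave only \<open>k = a1\<close>.\<close>

lemma cg_top_weight:
  assumes "a1 \<le> A + N" "a2 \<le> B + N"
  shows "(cg (A + N) (B + N) (A + B) a1 a2 0)\<^sup>2 = (if a1 + a2 = N then
     real (((A + N - a1) choose (N - a1)) * ((B + a1) choose a1)) / real ((A + B + N + 1) choose N) else 0)"
proof (cases "a1 + a2 = N")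
  case True
  let ?P = "real (A + B + 1) * fact N * fact A * fact B / fact (A + B + N + 1)"
  let ?F = "fact (A + N - a1) * fact a1 * fact (B + N - a2) * fact a2 * fact (A + B - 0) * fact 0 :: real"
  have K: "{k. k \<le> N \<and> k \<le> a1 \<and> k + a2 \<le> B + N \<and> a1 \<le> A + k \<and> N \<le> a2 + k} = {a1}"
    using True by auto
  have "(cg (A + N) (B + N) (A + B) a1 a2 0)\<^sup>2 = ?P * ?F * (1 / (fact a1 * fact (N - a1) * fact B * fact A))\<^sup>2"
    unfolding cg_racah[OF assms le0] K using True
    by (auto simp: power_mult_distrib power_divide simp flip: power_mult)
  also have "\<dots> = real (((A + N - a1) choose (N - a1)) * ((B + a1) choose a1)) / real ((A + B + N + 1) choose N)"
  proof -
    have e: "B + N - a2 = B + a1" "a2 = N - a1" "A + N - a1 - (N - a1) = A" "a1 \<le> N"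
      using True by auto
    have f: "fact (A + B + 1) = real (A + B + 1) * fact (A + B)" by simp
    have "real ((A + N - a1) choose (N - a1)) = fact (A + N - a1) / (fact (N - a1) * fact A)"
      using e by (subst binomial_fact) auto
    moreover have "real ((B + a1) choose a1) = fact (B + a1) / (fact a1 * fact B)"
      by (subst binomial_fact) auto
    moreover have "real ((A + B + N + 1) choose N) = fact (A + B + N + 1) / (fact N * (real (A + B + 1) * fact (A + B)))"
      unfolding f [symmetric] by (subst binomial_fact) (auto simp del: fact_Suc)
    ultimately have "real (((A + N - a1) choose (N - a1)) * ((B + a1) choose a1)) / real ((A + B + N + 1) choose N) =
      (fact (A + N - a1) / (fact (N - a1) * fact A)) * (fact (B + a1) / (fact a1 * fact B)) /
      (fact (A + B + N + 1) / (fact N * (real (A + B + 1) * fact (A + B))))"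
      by (simp only: of_nat_mult)
    also have "\<dots> = ?P * ?F * (1 / (fact a1 * fact (N - a1) * fact B * fact A))\<^sup>2"
      unfolding e(1) unfolding e(2) by (simp add: power2_eq_square divide_simps del: fact_Suc of_nat_add)
    finally show ?thesis by simp
  qed
  finally show ?thesis using True by simp
qed (simp add: cg_racah assms)

lemma cg_top_weight_norm:
  "(\<Sum>a1\<le>A + N. \<Sum>a2\<le>B + N. (cg (A + N) (B + N) (A + B) a1 a2 0)\<^sup>2) = 1"
proof -
  have "(\<Sum>a1\<le>A + N. \<Sum>a2\<le>B + N. (cg (A + N) (B + N) (A + B) a1 a2 0)\<^sup>2) =
     (\<Sum>a1\<le>A + N. \<Sum>a2\<le>B + N. if a2 = N - a1 \<and> a1 \<le> N then
     real (((A + N - a1) choose (N - a1)) * ((B + a1) choose a1)) / real ((A + B + N + 1) choose N) else 0)"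
    by (intro sum.cong refl) (auto simp: cg_top_weight)
  also have "\<dots> = (\<Sum>a1\<le>A + N. if a1 \<le> N then
     real (((A + N - a1) choose (N - a1)) * ((B + a1) choose a1)) / real ((A + B + N + 1) choose N) else 0)"
    by (intro sum.cong refl) (auto simp: sum.delta)
  also have "\<dots> = (\<Sum>a1\<le>N. real (((A + N - a1) choose (N - a1)) * ((B + a1) choose a1)) / real ((A + B + N + 1) choose N))"
    by (rule sum.mono_neutral_cong_right) auto
  also have "\<dots> = 1"
    unfolding sum_divide_distrib [symmetric] of_nat_sum [symmetric] vandermonde_hockey_stick by simp
  finally show ?thesis .
qed

section \<open>Matrix coefficients and equivariance\<close>

lemma pol_eq_iff2:
  assumes "\<And>x y u v. (\<Sum>a\<le>L. \<Sum>b\<le>M. c a b * (pol L a x y * pol M b u v)) =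
      (\<Sum>a\<le>L. \<Sum>b\<le>M. d a b * (pol L a x y * pol M b u v))"
    and "a \<le> L" "b \<le> M"
  shows "c a b = d a b"
proof -
  have "(\<Sum>b\<le>M. c a b * pol M b u v) = (\<Sum>b\<le>M. d a b * pol M b u v)" for u v
    by (rule pol_eq_iff[OF _ assms(2)])
      (use assms(1)[of _ _ u v] in \<open>simp add: sum_distrib_left sum_distrib_right mult_ac\<close>)
  then show ?thesis by (rule pol_eq_iff[OF _ assms(3)])
qed

lemma pol_eq_iff3:
  assumes "\<And>x y u v s t. (\<Sum>a\<le>L. \<Sum>b\<le>M. \<Sum>e\<le>R. c a b e * (pol L a x y * pol M b u v * pol R e s t)) =
      (\<Sum>a\<le>L. \<Sum>b\<le>M. \<Sum>e\<le>R. d a b e * (pol L a x y * pol M b u v * pol R e s t))"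
    and "a \<le> L" "b \<le> M" "e \<le> R"
  shows "c a b e = d a b e"
proof -
  have "(\<Sum>e\<le>R. c a b e * pol R e s t) = (\<Sum>e\<le>R. d a b e * pol R e s t)" for s t
    by (rule pol_eq_iff2[OF _ assms(2,3)])
      (use assms(1)[of _ _ _ _ s t] in \<open>simp add: sum_distrib_left sum_distrib_right mult_ac\<close>)
  then show ?thesis by (rule pol_eq_iff[OF _ assms(4)])
qed

text \<open>Homogeneous polynomials of degree \<open>L\<close> as functions; spelled with \<open>pol\<close> because coordinates in this
  basis are wanted.\<close>

definition homog :: "nat \<Rightarrow> (complex \<Rightarrow> complex \<Rightarrow> complex) \<Rightarrow> bool" where
  "homog L f \<longleftrightarrow> (\<exists>c. \<forall>x y. f x y = (\<Sum>b\<le>L. c b * pol L b x y))"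

lemma homog_monomials:
  "homog L f \<longleftrightarrow> (\<exists>c. \<forall>x y. f x y = (\<Sum>b\<le>L. c b * x ^ b * y ^ (L - b)))"
proof
  assume "homog L f"
  then obtain c where "\<forall>x y. f x y = (\<Sum>b\<le>L. c b * pol L b x y)" by (auto simp: homog_def)
  then show "\<exists>c. \<forall>x y. f x y = (\<Sum>b\<le>L. c b * x ^ b * y ^ (L - b))"
    by (intro exI[of _ "\<lambda>b. c b * complex_of_real (sqrt (real (L choose b)))"]) (simp add: pol_def mult.assoc)
next
  assume "\<exists>c. \<forall>x y. f x y = (\<Sum>b\<le>L. c b * x ^ b * y ^ (L - b))"
  then obtain c where c: "\<And>x y. f x y = (\<Sum>b\<le>L. c b * x ^ b * y ^ (L - b))" by blast
  show "homog L f" unfolding homog_def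
    by (rule exI[of _ "\<lambda>b. c b / complex_of_real (sqrt (real (L choose b)))"])
      (auto simp: c pol_def intro!: sum.cong)
qed

lemma homog_linear_mult:
  assumes "homog L f"
  shows "homog (Suc L) (\<lambda>x y. (\<alpha> * x + \<beta> * y) * f x y)"
proof -
  obtain c where c: "\<And>x y. f x y = (\<Sum>b\<le>L. c b * x ^ b * y ^ (L - b))"
    using assms by (auto simp: homog_monomials)
  define d where "d b = (if b = 0 then 0 else \<alpha> * c (b - 1)) + (if b = Suc L then 0 else \<beta> * c b)" for b
  have "(\<alpha> * x + \<beta> * y) * f x y = (\<Sum>b\<le>Suc L. d b * x ^ b * y ^ (Suc L - b))" for x y
  proof -
    have "(\<Sum>b\<le>Suc L. d b * x ^ b * y ^ (Suc L - b)) =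
        (\<Sum>b\<le>Suc L. (if b = 0 then 0 else \<alpha> * c (b - 1)) * x ^ b * y ^ (Suc L - b)) +
        (\<Sum>b\<le>Suc L. (if b = Suc L then 0 else \<beta> * c b) * x ^ b * y ^ (Suc L - b))"
      by (simp add: d_def ring_distribs sum.distrib)
    also have "(\<Sum>b\<le>Suc L. (if b = 0 then 0 else \<alpha> * c (b - 1)) * x ^ b * y ^ (Suc L - b)) = \<alpha> * x * f x y"
      by (subst sum.atMost_Suc_shift) (simp add: c sum_distrib_left mult_ac)
    also have "(\<Sum>b\<le>Suc L. (if b = Suc L then 0 else \<beta> * c b) * x ^ b * y ^ (Suc L - b)) = \<beta> * y * f x y"
      unfolding c sum_distrib_left by (simp, intro sum.cong refl) (auto simp: Suc_diff_le mult_ac)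
    finally show ?thesis by (simp add: ring_distribs)
  qed
  then show ?thesis unfolding homog_monomials by blast
qed

lemma homog_linear_powers: "homog (m + n) (\<lambda>x y. (\<alpha> * x + \<beta> * y) ^ m * (\<gamma> * x + \<delta> * y) ^ n)"
proof (induction m)
  case 0
  show ?case
  proof (induction n)
    case 0
    show ?case by (auto simp: homog_monomials intro: exI[of _ "\<lambda>_. 1"])
  next
    case (Suc n)
    from homog_linear_mult[OF this, of \<gamma> \<delta>] show ?case by (simp add: mult.left_commute)
  qed
next
  case (Suc m)
  from homog_linear_mult[OF this, of \<alpha> \<beta>] show ?case by (simp add: mult_ac)
qed

text \<open>The entries of \<open>Trep k\<close> in the basis \<open>psi\<close>; the arguments of \<open>pol L a\<close> are the coordinates of
  \<open>transpose k *v (x, y)\<close>.\<close>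

definition tmat :: "mat2 \<Rightarrow> nat \<Rightarrow> nat \<Rightarrow> nat \<Rightarrow> complex" where
  "tmat k L b a = (SOME t. \<forall>x y. pol L a (k$1$1 * x + k$2$1 * y) (k$1$2 * x + k$2$2 * y) =
     (\<Sum>b\<le>L. t b * pol L b x y)) b"

lemma tmat:
  assumes "a \<le> L"
  shows "pol L a (k$1$1 * x + k$2$1 * y) (k$1$2 * x + k$2$2 * y) = (\<Sum>b\<le>L. tmat k L b a * pol L b x y)"
proof -
  have "homog L (\<lambda>x y. pol L a (k$1$1 * x + k$2$1 * y) (k$1$2 * x + k$2$2 * y))"
  proof -
    obtain c where c: "\<And>x y. (k$1$1 * x + k$2$1 * y) ^ a * (k$1$2 * x + k$2$2 * y) ^ (L - a) =
       (\<Sum>b\<le>L. c b * pol L b x y)"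
      using homog_linear_powers[of a "L - a" "k$1$1" "k$2$1" "k$1$2" "k$2$2"] assms
      unfolding homog_def by auto
    show ?thesis unfolding homog_def
      by (rule exI[of _ "\<lambda>b. complex_of_real (sqrt (real (L choose a))) * c b"])
       (simp add: pol_def[of L a] c mult.assoc sum_distrib_left)
  qed
  then have "\<exists>t. \<forall>x y. pol L a (k$1$1 * x + k$2$1 * y) (k$1$2 * x + k$2$2 * y) = (\<Sum>b\<le>L. t b * pol L b x y)"
    by (simp add: homog_def)
  from someI_ex[OF this] show ?thesis unfolding tmat_def by blast
qed

text \<open>The kernel \<open>(x * u + y * v) ^ L\<close> depends only on the bilinear pairing of its two vectors, so a
  transposed matrix can be moved from one vector to the other.\<close>

lemma tmat_transpose:
  assumes "a \<le> L" "b \<le> L"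
  shows "tmat (transpose k) L b a = tmat k L a b"
proof -
  have "(\<Sum>a\<le>L. \<Sum>b\<le>L. tmat k L a b * (pol L a x y * pol L b u v)) =
        (\<Sum>a\<le>L. \<Sum>b\<le>L. tmat (transpose k) L b a * (pol L a x y * pol L b u v))" for x y u v
  proof -
    have "(\<Sum>a\<le>L. \<Sum>b\<le>L. tmat k L a b * (pol L a x y * pol L b u v)) =
        (\<Sum>b\<le>L. pol L b (k$1$1 * x + k$2$1 * y) (k$1$2 * x + k$2$2 * y) * pol L b u v)"
      by (subst sum.swap, intro sum.cong refl, subst tmat) (simp_all add: sum_distrib_right mult.assoc)
    also have "\<dots> = (\<Sum>a\<le>L. pol L a x y * pol L a (k$1$1 * u + k$1$2 * v) (k$2$1 * u + k$2$2 * v))"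
      unfolding pol_kernel by (simp add: algebra_simps)
    also have "\<dots> = (\<Sum>a\<le>L. pol L a x y * (\<Sum>b\<le>L. tmat (transpose k) L b a * pol L b u v))"
      using tmat[of _ L "transpose k" u v] by (simp add: transpose_def)
    also have "\<dots> = (\<Sum>a\<le>L. \<Sum>b\<le>L. tmat (transpose k) L b a * (pol L a x y * pol L b u v))"
      by (simp add: sum_distrib_left mult_ac)
    finally show ?thesis .
  qed
  from pol_eq_iff2[OF this assms] show ?thesis by simp
qed

text \<open>Both sides are the coefficients of one polynomial.  Applying the transpose of \<open>k\<close> to \<open>z\<close> and \<open>w\<close> in
  the generating function multiplies \<open>[z, w]\<close> by \<open>det k = 1\<close> and changes the pairings with \<open>u\<close> in the
  same way as applying \<open>k\<close> to \<open>u\<close>.\<close>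

lemma cg_equivariant:
  assumes det: "det k = 1" and a: "a1' \<le> A + N" "a2' \<le> B + N" "a \<le> A + B"
  shows "(\<Sum>a1\<le>A + N. \<Sum>a2\<le>B + N. of_real (cg (A + N) (B + N) (A + B) a1 a2 a) *
       (tmat k (A + N) a1' a1 * tmat k (B + N) a2' a2)) =
     (\<Sum>a'\<le>A + B. of_real (cg (A + N) (B + N) (A + B) a1' a2' a') * tmat k (A + B) a' a)"
proof -
  let ?c = "\<lambda>a1 a2 a. complex_of_real (cg (A + N) (B + N) (A + B) a1 a2 a)"
  let ?x = "\<lambda>x y. k$1$1 * x + k$2$1 * y" and ?y = "\<lambda>x y. k$1$2 * x + k$2$2 * y"
  let ?u = "\<lambda>x y. k$1$1 * x + k$1$2 * y" and ?v = "\<lambda>x y. k$2$1 * x + k$2$2 * y"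
  have "(\<Sum>b1\<le>A + N. \<Sum>b2\<le>B + N. \<Sum>b\<le>A + B. (\<Sum>a1\<le>A + N. \<Sum>a2\<le>B + N. ?c a1 a2 b *
       (tmat k (A + N) b1 a1 * tmat k (B + N) b2 a2)) * (pol (A + N) b1 z1 z2 * pol (B + N) b2 w1 w2 * pol (A + B) b u1 u2)) =
     (\<Sum>b1\<le>A + N. \<Sum>b2\<le>B + N. \<Sum>b\<le>A + B. (\<Sum>a\<le>A + B. ?c b1 b2 a * tmat k (A + B) a b) *
        (pol (A + N) b1 z1 z2 * pol (B + N) b2 w1 w2 * pol (A + B) b u1 u2))" (is "?l = ?r")
    for z1 z2 w1 w2 u1 u2
  proof -
    have "?l = (\<Sum>a1\<le>A + N. \<Sum>a2\<le>B + N. \<Sum>b\<le>A + B. ?c a1 a2 b *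
        (pol (A + N) a1 (?x z1 z2) (?y z1 z2) * pol (B + N) a2 (?x w1 w2) (?y w1 w2) * pol (A + B) b u1 u2))"
    proof -
      have "?l = (\<Sum>b\<le>A + B. pol (A + B) b u1 u2 * (\<Sum>b1\<le>A + N. \<Sum>b2\<le>B + N. \<Sum>a1\<le>A + N. \<Sum>a2\<le>B + N. ?c a1 a2 b *
       ((tmat k (A + N) b1 a1 * pol (A + N) b1 z1 z2) * (tmat k (B + N) b2 a2 * pol (B + N) b2 w1 w2))))"
        by (simp add: sum.swap[of _ "{..A + B}"] sum_distrib_left sum_distrib_right mult_ac)
      also have "\<dots> = (\<Sum>b\<le>A + B. pol (A + B) b u1 u2 * (\<Sum>a1\<le>A + N. \<Sum>a2\<le>B + N. ?c a1 a2 b *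
        ((\<Sum>b1\<le>A + N. tmat k (A + N) b1 a1 * pol (A + N) b1 z1 z2) *
         (\<Sum>b2\<le>B + N. tmat k (B + N) b2 a2 * pol (B + N) b2 w1 w2))))"
      proof -
        have "(\<Sum>b1\<le>A + N. \<Sum>b2\<le>B + N. \<Sum>a1\<le>A + N. \<Sum>a2\<le>B + N. f a1 a2 * (g b1 a1 * h b2 a2)) =
          (\<Sum>a1\<le>A + N. \<Sum>a2\<le>B + N. f a1 a2 * ((\<Sum>b1\<le>A + N. g b1 a1) * (\<Sum>b2\<le>B + N. h b2 a2)))"
          for f g h :: "nat \<Rightarrow> nat \<Rightarrow> complex"
          by (subst sum_swap_pairs) (simp flip: sum_distrib_left sum_distrib_right)
        then show ?thesis by simp
      qed
      also have "\<dots> = (\<Sum>b\<le>A + B. pol (A + B) b u1 u2 * (\<Sum>a1\<le>A + N. \<Sum>a2\<le>B + N. ?c a1 a2 b *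
         (pol (A + N) a1 (?x z1 z2) (?y z1 z2) * pol (B + N) a2 (?x w1 w2) (?y w1 w2))))"
        by (simp add: tmat cong: sum.cong_simp)
      also have "\<dots> = (\<Sum>a1\<le>A + N. \<Sum>a2\<le>B + N. \<Sum>b\<le>A + B. ?c a1 a2 b *
        (pol (A + N) a1 (?x z1 z2) (?y z1 z2) * pol (B + N) a2 (?x w1 w2) (?y w1 w2) * pol (A + B) b u1 u2))"
        by (simp add: sum.swap[of _ "{..A + B}"] sum_distrib_left sum_distrib_right mult_ac)
      finally show ?thesis .
    qed
    also have "\<dots> = of_real (kappa A B N) * ((?y z1 z2 * ?x w1 w2 - ?x z1 z2 * ?y w1 w2) ^ N *
        (?x z1 z2 * u1 + ?y z1 z2 * u2) ^ A * (?x w1 w2 * u1 + ?y w1 w2 * u2) ^ B)"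
      by (rule racah_generating_function)
    also have "?y z1 z2 * ?x w1 w2 - ?x z1 z2 * ?y w1 w2 = det k * (z2 * w1 - z1 * w2)"
      by (simp add: det_2 algebra_simps)
    also have "\<dots> = z2 * w1 - z1 * w2" by (simp add: det)
    also have "?x z1 z2 * u1 + ?y z1 z2 * u2 = z1 * ?u u1 u2 + z2 * ?v u1 u2" by (simp add: algebra_simps)
    also have "?x w1 w2 * u1 + ?y w1 w2 * u2 = w1 * ?u u1 u2 + w2 * ?v u1 u2" by (simp add: algebra_simps)
    also have "of_real (kappa A B N) * ((z2 * w1 - z1 * w2) ^ N * (z1 * ?u u1 u2 + z2 * ?v u1 u2) ^ A *
        (w1 * ?u u1 u2 + w2 * ?v u1 u2) ^ B) = (\<Sum>a1\<le>A + N. \<Sum>a2\<le>B + N. \<Sum>a\<le>A + B. ?c a1 a2 a *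
      (pol (A + N) a1 z1 z2 * pol (B + N) a2 w1 w2 * pol (A + B) a (?u u1 u2) (?v u1 u2)))"
      by (rule racah_generating_function [symmetric])
    also have "\<dots> = (\<Sum>a1\<le>A + N. \<Sum>a2\<le>B + N. \<Sum>a\<le>A + B. ?c a1 a2 a *
      (pol (A + N) a1 z1 z2 * pol (B + N) a2 w1 w2 * (\<Sum>b\<le>A + B. tmat k (A + B) a b * pol (A + B) b u1 u2)))"
    proof (intro sum.cong refl)
      fix a assume "a \<in> {..A + B}"
      then show "?c a1 a2 a * (pol (A + N) a1 z1 z2 * pol (B + N) a2 w1 w2 * pol (A + B) a (?u u1 u2) (?v u1 u2)) =
        ?c a1 a2 a * (pol (A + N) a1 z1 z2 * pol (B + N) a2 w1 w2 * (\<Sum>b\<le>A + B. tmat k (A + B) a b * pol (A + B) b u1 u2))" for a1 a2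
        using tmat[of a "A + B" "transpose k" u1 u2] by (simp add: transpose_def tmat_transpose[unfolded transpose_def])
    qed
    also have "\<dots> = ?r"
    proof -
      have "(\<Sum>a\<le>A + B. c a * (p * (\<Sum>b\<le>A + B. t a b * q b))) = (\<Sum>b\<le>A + B. (\<Sum>a\<le>A + B. c a * t a b) * (p * q b))"
        for c q :: "nat \<Rightarrow> complex" and p t
        by (simp only: sum_distrib_left sum_distrib_right, subst sum.swap) (simp add: mult_ac)
      then show ?thesis by simp
    qed
    finally show ?thesis .
  qed
  from pol_eq_iff3[OF this a] show ?thesis .
qed

section \<open>Coupling with spin one half\<close>

definition pol_dx :: "nat \<Rightarrow> nat \<Rightarrow> complex \<Rightarrow> complex \<Rightarrow> complex" where
  "pol_dx L a x y = complex_of_real (sqrt (real (L choose a))) * (of_nat a * x ^ (a - 1)) * y ^ (L - a)"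

definition pol_dy :: "nat \<Rightarrow> nat \<Rightarrow> complex \<Rightarrow> complex \<Rightarrow> complex" where
  "pol_dy L a x y = complex_of_real (sqrt (real (L choose a))) * x ^ a * (of_nat (L - a) * y ^ (L - a - 1))"

lemma DERIV_pol_x: "((\<lambda>x. pol L a x y) has_field_derivative pol_dx L a x y) (at x)"
  unfolding pol_def pol_dx_def by (auto intro!: derivative_eq_intros)

lemma DERIV_pol_y: "((\<lambda>y. pol L a x y) has_field_derivative pol_dy L a x y) (at y)"
  unfolding pol_def pol_dy_def by (auto intro!: derivative_eq_intros)

lemma pol_kernel_dx:
  "(\<Sum>a\<le>L. pol L a x y * pol_dx L a u v) = of_nat L * (x * u + y * v) ^ (L - 1) * x"
proof (rule DERIV_unique)
  show "((\<lambda>u. \<Sum>a\<le>L. pol L a x y * pol L a u v) has_field_derivative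
      (\<Sum>a\<le>L. pol L a x y * pol_dx L a u v)) (at u)"
    by (intro DERIV_sum DERIV_cmult DERIV_pol_x)
  show "((\<lambda>u. \<Sum>a\<le>L. pol L a x y * pol L a u v) has_field_derivative
      of_nat L * (x * u + y * v) ^ (L - 1) * x) (at u)"
    unfolding pol_kernel by (auto intro!: derivative_eq_intros)
qed

lemma pol_kernel_dy:
  "(\<Sum>a\<le>L. pol L a x y * pol_dy L a u v) = of_nat L * (x * u + y * v) ^ (L - 1) * y"
proof (rule DERIV_unique)
  show "((\<lambda>v. \<Sum>a\<le>L. pol L a x y * pol L a u v) has_field_derivative
      (\<Sum>a\<le>L. pol L a x y * pol_dy L a u v)) (at v)"
    by (intro DERIV_sum DERIV_cmult DERIV_pol_y)
  show "((\<lambda>v. \<Sum>a\<le>L. pol L a x y * pol L a u v) has_field_derivative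
      of_nat L * (x * u + y * v) ^ (L - 1) * y) (at v)"
    unfolding pol_kernel by (auto intro!: derivative_eq_intros)
qed

text \<open>The form in which the third vector is kept as a parameter; the spins are free variables tied to
  \<open>A\<close>, \<open>B\<close>, \<open>N\<close> by equations, so that the lemma applies to sums whose bounds are not literally sums.\<close>

lemma racah_generating_function_contracted:
  assumes "L1 = A + N" "L2 = B + N" "L = A + B"
  shows "(\<Sum>a1\<le>L1. \<Sum>a2\<le>L2. (\<Sum>a\<le>L. of_real (cg L1 L2 L a1 a2 a) * pol L a u1 u2) *
      (pol L1 a1 z1 z2 * pol L2 a2 w1 w2)) =
   of_real (kappa A B N) *
     ((z2 * w1 - z1 * w2) ^ N * (z1 * u1 + z2 * u2) ^ A * (w1 * u1 + w2 * u2) ^ B)"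
  unfolding assms racah_generating_function [symmetric] sum_distrib_right
  by (simp only: mult_ac)

lemma kappa_half_plus: "kappa L (Suc 0) 0 = 1"
  by (simp add: kappa_def add_divide_distrib divide_simps real_sqrt_mult)

lemma kappa_half_minus: "kappa A 0 (Suc 0) = sqrt (real (A + 1) / real (A + 2))"
  by (simp add: kappa_def real_sqrt_mult real_sqrt_divide divide_simps)

text \<open>Coupling with spin one half to the larger spin is multiplication of polynomials.\<close>

lemma cg_half_plus_pol:
  assumes "a \<le> L" "i \<le> 1"
  shows "(\<Sum>n\<le>L + 1. of_real (cg L 1 (L + 1) a i n) * pol (L + 1) n u v) = pol L a u v * pol 1 i u v"
proof -
  have "(\<Sum>a\<le>L. \<Sum>i\<le>1. (\<Sum>n\<le>L + 1. of_real (cg L 1 (L + 1) a i n) * pol (L + 1) n u v) * (pol L a x y * pol 1 i s t)) =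
     (\<Sum>a\<le>L. \<Sum>i\<le>1. (pol L a u v * pol 1 i u v) * (pol L a x y * pol 1 i s t))" for x y s t
  proof -
    have "(\<Sum>a\<le>L. \<Sum>i\<le>1. (\<Sum>n\<le>L + 1. of_real (cg L 1 (L + 1) a i n) * pol (L + 1) n u v) * (pol L a x y * pol 1 i s t)) =
       (x * u + y * v) ^ L * (s * u + t * v) ^ 1"
      by (subst racah_generating_function_contracted[of _ L 0 _ 1]) (simp_all add: kappa_half_plus)
    also have "\<dots> = (\<Sum>a\<le>L. \<Sum>i\<le>1. (pol L a u v * pol 1 i u v) * (pol L a x y * pol 1 i s t))"
      unfolding pol_kernel [symmetric] sum_product by (simp add: mult_ac)
    finally show ?thesis .
  qed
  from pol_eq_iff2[OF this assms] show ?thesis .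
qed

text \<open>Coupling with spin one half to the smaller spin is differentiation: \<open>[z, s] * (z \<bullet> u) ^ A\<close> is, up
  to the factor \<open>A + 1\<close>, a combination of the two partial derivatives of \<open>(z \<bullet> u) ^ (A + 1)\<close> in \<open>u\<close>.\<close>

lemma cg_half_minus_pol:
  assumes "a \<le> A + 1" "i \<le> 1"
  shows "(\<Sum>n\<le>A. of_real (cg (A + 1) 1 A a i n) * pol A n u v) =
     of_real (kappa A 0 1 / real (A + 1)) * (if i = 0 then - pol_dx (A + 1) a u v else pol_dy (A + 1) a u v)"
proof -
  let ?E = "\<lambda>a i. of_real (kappa A 0 1 / real (A + 1)) * (if i = 0 then - pol_dx (A + 1) a u v else pol_dy (A + 1) a u v)"
  have "(\<Sum>a\<le>A + 1. \<Sum>i\<le>1. (\<Sum>n\<le>A. of_real (cg (A + 1) 1 A a i n) * pol A n u v) * (pol (A + 1) a x y * pol 1 i s t)) =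
     (\<Sum>a\<le>A + 1. \<Sum>i\<le>1. ?E a i * (pol (A + 1) a x y * pol 1 i s t))" for x y s t
  proof -
    have "(\<Sum>a\<le>A + 1. \<Sum>i\<le>1. (\<Sum>n\<le>A. of_real (cg (A + 1) 1 A a i n) * pol A n u v) * (pol (A + 1) a x y * pol 1 i s t)) =
       of_real (kappa A 0 1) * ((y * s - x * t) * (x * u + y * v) ^ A)"
      by (subst racah_generating_function_contracted[of _ A 1 _ 0]) simp_all
    also have "\<dots> = of_real (kappa A 0 1 / real (A + 1)) * 
       (s * (of_nat (A + 1) * (x * u + y * v) ^ (A + 1 - 1) * y) - t * (of_nat (A + 1) * (x * u + y * v) ^ (A + 1 - 1) * x))"
      by (simp add: field_simps del: of_nat_Suc)
    also have "\<dots> = (\<Sum>a\<le>A + 1. of_real (kappa A 0 1 / real (A + 1)) * 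
       (s * (pol (A + 1) a x y * pol_dy (A + 1) a u v) - t * (pol (A + 1) a x y * pol_dx (A + 1) a u v)))"
      unfolding pol_kernel_dx [symmetric] pol_kernel_dy [symmetric] sum_distrib_left sum_subtractf [symmetric] ..
    also have "\<dots> = (\<Sum>a\<le>A + 1. \<Sum>i\<le>1. ?E a i * (pol (A + 1) a x y * pol 1 i s t))"
      by (intro sum.cong refl) (simp add: pol_def[of "Suc 0"] algebra_simps)
    finally show ?thesis .
  qed
  from pol_eq_iff2[OF this assms] show ?thesis .
qed

lemma cg_half_plus:
  assumes "a \<le> L" "i \<le> 1" "n \<le> L + 1"
  shows "cg L 1 (L + 1) a i n =
    (if n = a + i then sqrt (if i = 0 then real (L + 1 - a) / real (L + 1) else real (a + 1) / real (L + 1)) else 0)"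
    (is "_ = (if _ then sqrt ?r else 0)")
proof -
  have "real (L choose a) = ?r * real ((L + 1) choose (a + i))"
  proof (cases "i = 0")
    case True
    have "real (L + 1 - a) * real ((L + 1) choose a) = real (L + 1) * real (L choose a)"
      using binomial_absorb_comp[of "L + 1" a] by (simp only: of_nat_mult [symmetric] add_diff_cancel_right')
    then show ?thesis using True by (simp add: field_simps)
  next
    case False
    then have "i = 1" using assms by simp
    have "real (a + 1) * real ((L + 1) choose (a + 1)) = real (L + 1) * real (L choose a)"
      using Suc_times_binomial[of a L] by (simp only: of_nat_mult [symmetric] Suc_eq_plus1)
    then show ?thesis using \<open>i = 1\<close> by (simp add: field_simps)
  qed
  then have "sqrt (real (L choose a)) = sqrt ?r * sqrt (real ((L + 1) choose (a + i)))"
    by (simp only: real_sqrt_mult)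
  then have "pol L a u v * pol 1 i u v = of_real (sqrt ?r) * pol (L + 1) (a + i) u v" for u v
    unfolding pol_def using assms by (auto simp: le_Suc_eq Suc_diff_le)
  then have "(\<Sum>n\<le>L + 1. of_real (cg L 1 (L + 1) a i n) * pol (L + 1) n u v) =
     (\<Sum>n\<le>L + 1. of_real (if n = a + i then sqrt ?r else 0) * pol (L + 1) n u v)" for u v
    unfolding cg_half_plus_pol[OF assms(1,2)] using assms by (subst sum_single) auto
  from pol_eq_iff[OF this assms(3)] show ?thesis by (simp only: of_real_eq_iff)
qed

lemma sqrt_scaling:
  assumes "p > 0" "a \<ge> 0"
  shows "sqrt (p / q) / p * sqrt c * a = sqrt (a / q) * sqrt (a * c / p)"
proof -
  obtain s t where "p = s * s" "s > 0" "a = t * t" "t \<ge> 0"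
    using assms by (metis real_sqrt_ge_0_iff real_sqrt_gt_0_iff real_sqrt_mult_self abs_of_nonneg abs_of_pos)
  then show ?thesis by (simp add: real_sqrt_mult real_sqrt_divide field_simps)
qed

lemma cg_half_minus:
  assumes "a \<le> A + 1" "i \<le> 1" "n \<le> A"
  shows "cg (A + 1) 1 A a i n =
    (if n + 1 = a + i then if i = 0 then - sqrt (real a / real (A + 2)) else sqrt (real (A + 1 - a) / real (A + 2)) else 0)"
proof -
  let ?k = "kappa A 0 1 / real (A + 1)"
  let ?r = "if i = 0 then - sqrt (real a / real (A + 2)) else sqrt (real (A + 1 - a) / real (A + 2))"
  have dx: "?k * sqrt (real ((A + 1) choose a)) * real a = sqrt (real a / real (A + 2)) * sqrt (real (A choose (a - 1)))"
    if nz: "a \<noteq> 0"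
  proof -
    have "real a * real ((A + 1) choose a) = real (A + 1) * real (A choose (a - 1))"
    proof -
      obtain b where "a = Suc b" using nz by (cases a) auto
      then show ?thesis
        using Suc_times_binomial[of b A]
        by (simp only: of_nat_mult [symmetric] Suc_eq_plus1 add_diff_cancel_right')
    qed
    then have "real (A choose (a - 1)) = real a * real ((A + 1) choose a) / real (A + 1)"
      by (simp add: field_simps)
    then show ?thesis
      using sqrt_scaling[of "real (A + 1)" "real a" "real (A + 2)" "real ((A + 1) choose a)"]
      by (simp add: kappa_half_minus)
  qed
  have dy: "?k * sqrt (real ((A + 1) choose a)) * real (A + 1 - a) = sqrt (real (A + 1 - a) / real (A + 2)) * sqrt (real (A choose a))"
  proof -
    have "real (A + 1 - a) * real ((A + 1) choose a) = real (A + 1) * real (A choose a)"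
      using binomial_absorb_comp[of "A + 1" a] by (simp only: of_nat_mult [symmetric] add_diff_cancel_right')
    then have "real (A choose a) = real (A + 1 - a) * real ((A + 1) choose a) / real (A + 1)"
      by (simp add: field_simps)
    then show ?thesis
      using sqrt_scaling[of "real (A + 1)" "real (A + 1 - a)" "real (A + 2)" "real ((A + 1) choose a)"]
      by (simp add: kappa_half_minus del: binomial_Suc_Suc)
  qed
  have "(\<Sum>n\<le>A. of_real (cg (A + 1) 1 A a i n) * pol A n u v) =
     (\<Sum>n\<le>A. of_real (if n + 1 = a + i then ?r else 0) * pol A n u v)" for u v
    unfolding cg_half_minus_pol[OF assms(1,2)]
  proof (cases "1 \<le> a + i \<and> a + i \<le> A + 1")
    case True
    have "(\<Sum>n\<le>A. of_real (if n + 1 = a + i then ?r else 0) * pol A n u v) = of_real ?r * pol A (a + i - 1) u v"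
    proof -
      have e: "n + 1 = a + i \<longleftrightarrow> n = a + i - 1" for n using True by auto
      show ?thesis unfolding e by (rule sum_single) (use True in auto)
    qed
    also have "\<dots> = of_real ?k * (if i = 0 then - pol_dx (A + 1) a u v else pol_dy (A + 1) a u v)"
    proof (cases "i = 0")
      case i: True
      then have "a \<noteq> 0" "A + 1 - a = A - (a - 1)" using True by auto
      have "of_real ?k * pol_dx (A + 1) a u v =
          of_real (?k * sqrt (real ((A + 1) choose a)) * real a) * (u ^ (a - 1) * v ^ (A + 1 - a))"
        by (simp only: pol_dx_def of_real_mult of_real_of_nat_eq mult_ac)
      also have "\<dots> = of_real (sqrt (real a / real (A + 2))) * pol A (a - 1) u v"
        unfolding dx[OF \<open>a \<noteq> 0\<close>] \<open>A + 1 - a = A - (a - 1)\<close>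
        by (simp only: pol_def of_real_mult mult.assoc)
      finally show ?thesis using i by simp
    next
      case False
      then have i: "i = 1" using assms by simp
      have "of_real ?k * pol_dy (A + 1) a u v =
          of_real (?k * sqrt (real ((A + 1) choose a)) * real (A + 1 - a)) * (u ^ a * v ^ (A + 1 - a - 1))"
        by (simp only: pol_dy_def of_real_mult of_real_of_nat_eq mult_ac)
      also have "\<dots> = of_real (sqrt (real (A + 1 - a) / real (A + 2))) * pol A a u v"
        unfolding dy by (simp add: pol_def)
      finally show ?thesis using i by simp
    qed
    finally show "of_real ?k * (if i = 0 then - pol_dx (A + 1) a u v else pol_dy (A + 1) a u v) =
      (\<Sum>n\<le>A. of_real (if n + 1 = a + i then ?r else 0) * pol A n u v)" ..
  next
    case False
    then have "a = 0 \<and> i = 0 \<or> a = A + 1 \<and> i = 1" using assms by auto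
    then have "(if i = 0 then - pol_dx (A + 1) a u v else pol_dy (A + 1) a u v) = 0"
      by (auto simp: pol_dx_def pol_dy_def)
    moreover have "(\<Sum>n\<le>A. of_real (if n + 1 = a + i then ?r else 0) * pol A n u v) = 0"
      by (rule sum.neutral) (use False in auto)
    ultimately show "of_real ?k * (if i = 0 then - pol_dx (A + 1) a u v else pol_dy (A + 1) a u v) =
      (\<Sum>n\<le>A. of_real (if n + 1 = a + i then ?r else 0) * pol A n u v)"
      by (simp only: mult_zero_right)
  qed
  from pol_eq_iff[OF this assms(3)] show ?thesis by (simp only: of_real_eq_iff)
qed

text \<open>Twice the spins that occur in the product of spin \<open>L/2\<close> with spin one half.\<close>

definition half_spins :: "nat \<Rightarrow> nat set" where
  "half_spins L = (if L = 0 then {1} else {L - 1, L + 1})"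

lemma finite_half_spins [simp]: "finite (half_spins L)"
  by (simp add: half_spins_def)

text \<open>The coefficients form, for each total weight, an orthogonal matrix of size at most two, whose entries
  are known explicitly.  Here \<open>p\<close> and \<open>m\<close> are the entries for the larger and the smaller spin.\<close>

lemma cg_half_completeness:
  assumes "a \<le> L" "i \<le> 1" "a' \<le> L" "i' \<le> 1"
  shows "(\<Sum>M\<in>half_spins L. \<Sum>n\<le>M. cg L 1 M a i n * cg L 1 M a' i' n) = (if a = a' \<and> i = i' then 1 else 0)"
proof -
  define p where "p a i = sqrt (if i = 0 then real (L + 1 - a) / real (L + 1) else real (a + 1) / real (L + 1))" for a i :: nat
  define m where "m a i = (if i = 0 then - sqrt (real a / real (L + 1)) else sqrt (real (L - a) / real (L + 1)))" for a i :: nat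
  have plus: "(\<Sum>n\<le>L + 1. cg L 1 (L + 1) a i n * cg L 1 (L + 1) a' i' n) =
      (if a + i = a' + i' then p a i * p a' i' else 0)"
  proof -
    have c: "cg L (Suc 0) (Suc L) a i n = (if n = a + i then p a i else 0)" if "a \<le> L" "i \<le> 1" "n \<le> L + 1" for a i n
      using cg_half_plus[OF that] by (simp add: p_def)
    have "(\<Sum>n\<le>L + 1. cg L 1 (L + 1) a i n * cg L 1 (L + 1) a' i' n) =
       (\<Sum>n\<le>L + 1. if n = a + i then (if a + i = a' + i' then p a i * p a' i' else 0) else 0)"
      using assms by (intro sum.cong refl) (auto simp: c)
    then show ?thesis using assms by (subst (asm) sum.delta) auto
  qed
  have minus: "(\<Sum>M\<in>half_spins L - {L + 1}. \<Sum>n\<le>M. cg L 1 M a i n * cg L 1 M a' i' n) =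
      (if a + i = a' + i' then m a i * m a' i' else 0)"
  proof (cases L)
    case 0
    then show ?thesis using assms by (auto simp: half_spins_def m_def le_Suc_eq)
  next
    case (Suc A)
    have c: "cg L (Suc 0) A a i n = (if n + 1 = a + i then m a i else 0)" if "a \<le> L" "i \<le> 1" "n \<le> A" for a i n
      using cg_half_minus[of a A i n] that by (simp add: Suc m_def)
    have "(\<Sum>M\<in>half_spins L - {L + 1}. \<Sum>n\<le>M. cg L 1 M a i n * cg L 1 M a' i' n) =
       (\<Sum>n\<le>A. cg L 1 A a i n * cg L 1 A a' i' n)"
      by (simp add: half_spins_def Suc insert_Diff_if)
    also have "\<dots> = (\<Sum>n\<le>A. if n + 1 = a + i then (if a + i = a' + i' then m a i * m a' i' else 0) else 0)"
      using assms by (intro sum.cong refl) (auto simp: c)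
    also have "\<dots> = (if a + i = a' + i' then m a i * m a' i' else 0)"
    proof (cases "1 \<le> a + i \<and> a + i \<le> A + 1")
      case True
      then show ?thesis by (subst sum.remove[of _ "a + i - 1"]) (auto intro!: sum.neutral)
    next
      case False
      \<comment> \<open>The smaller spin has no weight for \<open>a + i\<close>; the entry \<open>m a i\<close> is zero there.\<close>
      then have "a + i = 0 \<or> a = L \<and> i = 1" using assms Suc by auto
      then have "m a i = 0" by (auto simp: m_def)
      then show ?thesis by (simp cong: if_cong)
    qed
    finally show ?thesis .
  qed
  have "(\<Sum>M\<in>half_spins L. \<Sum>n\<le>M. cg L 1 M a i n * cg L 1 M a' i' n) =
      (if a + i = a' + i' then p a i * p a' i' + m a i * m a' i' else 0)"
    using plus minus by (subst sum.remove[of _ "L + 1"]) (auto simp: half_spins_def)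
  also have "\<dots> = (if a = a' \<and> i = i' then 1 else 0)"
  proof -
    have diag: "p a i * p a i + m a i * m a i = 1"
      using assms by (auto simp: p_def m_def of_nat_diff add_divide_distrib [symmetric])
    have off: "p b 1 * p (b + 1) 0 + m b 1 * m (b + 1) 0 = 0" for b
      by (simp add: p_def m_def mult.commute)
    consider "i = i'" | "i = 0" "i' = 1" | "i = 1" "i' = 0" using assms by linarith
    then show ?thesis
    proof cases
      case 1
      then show ?thesis using diag by auto
    next
      case 2
      then show ?thesis using off[of a'] by (auto simp: mult.commute)
    next
      case 3
      then show ?thesis using off[of a] by auto
    qed
  qed
  finally show ?thesis .
qed

lemma half_spins_triple:
  assumes "M \<in> half_spins L"
  shows "\<exists>A B N. L = A + N \<and> 1 = B + N \<and> M = A + B"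
proof (cases "M = L + 1")
  case True
  then show ?thesis by (intro exI[of _ L] exI[of _ 1] exI[of _ 0]) simp
next
  case False
  then have "L = M + 1" using assms by (auto simp: half_spins_def split: if_splits)
  then show ?thesis by (intro exI[of _ M] exI[of _ 0] exI[of _ 1]) simp
qed

lemma sum_swap_half_spins:
  "(\<Sum>M\<in>half_spins L. \<Sum>n\<le>M. \<Sum>b\<in>B. \<Sum>j\<in>J. F M n b j) =
   (\<Sum>b\<in>B. \<Sum>j\<in>J. \<Sum>M\<in>half_spins L. \<Sum>n\<le>M. F M n b j)"
proof -
  have "(\<Sum>M\<in>half_spins L. \<Sum>n\<le>M. \<Sum>b\<in>B. \<Sum>j\<in>J. F M n b j) =
      (\<Sum>M\<in>half_spins L. \<Sum>b\<in>B. \<Sum>j\<in>J. \<Sum>n\<le>M. F M n b j)"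
    by (rule sum.cong[OF refl], rule sum_pull2 [symmetric])
  also have "\<dots> = (\<Sum>b\<in>B. \<Sum>j\<in>J. \<Sum>M\<in>half_spins L. \<Sum>n\<le>M. F M n b j)"
    by (rule sum_pull2 [symmetric])
  finally show ?thesis .
qed

text \<open>Equivariance says that the coupling map conjugates \<open>tmat k L \<otimes> tmat k 1\<close> into a block diagonal
  matrix, and completeness allows to invert that map.\<close>

lemma clebsch_gordan_series_half:
  assumes "det k = 1" "a \<le> L" "i \<le> 1" "a' \<le> L" "i' \<le> 1"
  shows "tmat k L a' a * tmat k 1 i' i =
    (\<Sum>M\<in>half_spins L. \<Sum>n\<le>M. \<Sum>n'\<le>M. of_real (cg L 1 M a i n * cg L 1 M a' i' n') * tmat k M n' n)"
proof -
  let ?c = "\<lambda>M a i n. complex_of_real (cg L 1 M a i n)"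
  have "(\<Sum>M\<in>half_spins L. \<Sum>n\<le>M. \<Sum>n'\<le>M. of_real (cg L 1 M a i n * cg L 1 M a' i' n') * tmat k M n' n) =
     (\<Sum>M\<in>half_spins L. \<Sum>n\<le>M. ?c M a i n * (\<Sum>n'\<le>M. ?c M a' i' n' * tmat k M n' n))"
    by (simp add: sum_distrib_left mult.assoc)
  also have "\<dots> = (\<Sum>M\<in>half_spins L. \<Sum>n\<le>M. ?c M a i n * (\<Sum>b\<le>L. \<Sum>j\<le>1. ?c M b j n * (tmat k L a' b * tmat k 1 i' j)))"
  proof (rule sum.cong[OF refl], rule sum.cong[OF refl])
    fix M n assume M: "M \<in> half_spins L" and n: "n \<in> {..M}"
    obtain A B N where ABN: "L = A + N" "1 = B + N" "M = A + B"
      using half_spins_triple[OF M] by blast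
    have "(\<Sum>b\<le>L. \<Sum>j\<le>1. ?c M b j n * (tmat k L a' b * tmat k 1 i' j)) =
        (\<Sum>n'\<le>M. ?c M a' i' n' * tmat k M n' n)"
      unfolding ABN using assms n by (intro cg_equivariant) (simp_all add: ABN [symmetric])
    then show "?c M a i n * (\<Sum>n'\<le>M. ?c M a' i' n' * tmat k M n' n) =
        ?c M a i n * (\<Sum>b\<le>L. \<Sum>j\<le>1. ?c M b j n * (tmat k L a' b * tmat k 1 i' j))"
      by (simp only:)
  qed
  also have "\<dots> = (\<Sum>M\<in>half_spins L. \<Sum>n\<le>M. \<Sum>b\<le>L. \<Sum>j\<le>1. of_real (cg L 1 M a i n * cg L 1 M b j n) * (tmat k L a' b * tmat k 1 i' j))"
    by (simp only: sum_distrib_left of_real_mult mult.assoc)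
  also have "\<dots> = (\<Sum>b\<le>L. \<Sum>j\<le>1. of_real (\<Sum>M\<in>half_spins L. \<Sum>n\<le>M. cg L 1 M a i n * cg L 1 M b j n) * (tmat k L a' b * tmat k 1 i' j))"
    by (simp only: of_real_sum sum_distrib_right sum_swap_half_spins)
  also have "\<dots> = (\<Sum>b\<le>L. \<Sum>j\<le>1. (if b = a then if j = i then tmat k L a' b * tmat k 1 i' j else 0 else 0))"
    using assms by (intro sum.cong refl, subst cg_half_completeness) auto
  also have "\<dots> = (\<Sum>b\<le>L. (if b = a then tmat k L a' b * tmat k 1 i' i else 0))"
    using assms by (intro sum.cong refl) (auto simp: sum.delta simp del: sum.atMost_Suc)
  also have "\<dots> = tmat k L a' a * tmat k 1 i' i" using assms by simp
  finally show ?thesis ..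
qed

section \<open>Recoupling with the singlet\<close>

text \<open>The coordinates in the part \<open>(M1, M2)\<close> of the tensor product of the image of the weight vector \<open>a\<close>
  under \<open>beta\<close> with the singlet.\<close>

definition recoupling :: "nat \<Rightarrow> nat \<Rightarrow> nat \<Rightarrow> nat \<Rightarrow> nat \<Rightarrow> nat \<Rightarrow> nat \<Rightarrow> nat \<Rightarrow> real" where
  "recoupling L1 L2 L M1 M2 n1 n2 a = (\<Sum>a1\<le>L1. \<Sum>a2\<le>L2. \<Sum>i1\<le>1. \<Sum>i2\<le>1.
     cg L1 L2 L a1 a2 a * cg 1 1 0 i1 i2 0 * cg L1 1 M1 a1 i1 n1 * cg L2 1 M2 a2 i2 n2)"

lemma cg_singlet:
  "cg 1 1 0 0 0 0 = 0" "cg 1 1 0 1 1 0 = 0" "cg 1 1 0 0 1 0 = 1 / sqrt 2" "cg 1 1 0 1 0 0 = - (1 / sqrt 2)"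
  using cg_half_minus[of 0 0 0 0] cg_half_minus[of 1 0 1 0] cg_half_minus[of 0 0 1 0] cg_half_minus[of 1 0 0 0]
  by (simp_all add: real_sqrt_divide)

lemma recoupling_singlet:
  "recoupling L1 L2 L M1 M2 n1 n2 a = (\<Sum>a1\<le>L1. \<Sum>a2\<le>L2. cg L1 L2 L a1 a2 a * (1 / sqrt 2 *
     (cg L1 1 M1 a1 0 n1 * cg L2 1 M2 a2 1 n2 - cg L1 1 M1 a1 1 n1 * cg L2 1 M2 a2 0 n2)))"
  unfolding recoupling_def using cg_singlet by (intro sum.cong refl) (simp add: algebra_simps)

context
  fixes L1 L2 L :: nat and u1 u2 :: complex
begin

text \<open>The coupled tensor with parameter \<open>u\<close>, with the basis vectors of its two factors replaced by
  arbitrary families \<open>X\<close> and \<open>Y\<close>.  For \<open>X a = pol L1 a z1 z2\<close> and \<open>Y a = pol L2 a w1 w2\<close> it is the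
  generating function; for partial derivatives of these families it is a partial derivative of it.\<close>

definition pairing :: "(nat \<Rightarrow> complex) \<Rightarrow> (nat \<Rightarrow> complex) \<Rightarrow> complex" where
  "pairing X Y = (\<Sum>a1\<le>L1. \<Sum>a2\<le>L2. (\<Sum>a\<le>L. of_real (cg L1 L2 L a1 a2 a) * pol L a u1 u2) * (X a1 * Y a2))"

lemma pairing_scale_left: "pairing (\<lambda>a. c * X a) Y = c * pairing X Y"
  by (simp add: pairing_def sum_distrib_left mult_ac)

lemma pairing_scale_right: "pairing X (\<lambda>a. c * Y a) = c * pairing X Y"
  by (simp add: pairing_def sum_distrib_left mult_ac)

lemma pairing_cong:
  "(\<And>a. a \<le> L1 \<Longrightarrow> X a = X' a) \<Longrightarrow> (\<And>a. a \<le> L2 \<Longrightarrow> Y a = Y' a) \<Longrightarrow> pairing X Y = pairing X' Y'"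
  unfolding pairing_def by (intro sum.cong refl) auto

lemma DERIV_pairing_left:
  assumes "\<And>a. ((\<lambda>x. X x a) has_field_derivative X' a) (at x)"
  shows "((\<lambda>x. pairing (X x) Y) has_field_derivative pairing X' Y) (at x)"
  unfolding pairing_def by (intro DERIV_sum DERIV_cmult DERIV_cmult_right assms)

lemma DERIV_pairing_right:
  assumes "\<And>a. ((\<lambda>x. Y x a) has_field_derivative Y' a) (at x)"
  shows "((\<lambda>x. pairing X (Y x)) has_field_derivative pairing X Y') (at x)"
  unfolding pairing_def by (intro DERIV_sum DERIV_cmult assms)

text \<open>Since the singlet is the antisymmetric tensor divided by \<open>sqrt 2\<close>, the recoupled tensor is a
  difference of two pairings.\<close>

lemma recoupling_generating_function:
  "(\<Sum>n1\<le>M1. \<Sum>n2\<le>M2. (\<Sum>a\<le>L. of_real (recoupling L1 L2 L M1 M2 n1 n2 a) * pol L a u1 u2) *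
      (pol M1 n1 z1 z2 * pol M2 n2 w1 w2)) =
   of_real (1 / sqrt 2) *
    (pairing (\<lambda>a. \<Sum>n\<le>M1. of_real (cg L1 1 M1 a 0 n) * pol M1 n z1 z2)
        (\<lambda>a. \<Sum>n\<le>M2. of_real (cg L2 1 M2 a 1 n) * pol M2 n w1 w2) -
     pairing (\<lambda>a. \<Sum>n\<le>M1. of_real (cg L1 1 M1 a 1 n) * pol M1 n z1 z2)
        (\<lambda>a. \<Sum>n\<le>M2. of_real (cg L2 1 M2 a 0 n) * pol M2 n w1 w2))"
proof -
  define S where "S a1 a2 = (\<Sum>a\<le>L. of_real (cg L1 L2 L a1 a2 a) * pol L a u1 u2)" for a1 a2
  define e where "e i n a = complex_of_real (cg L1 1 M1 a i n)" for i n a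
  define f where "f i n a = complex_of_real (cg L2 1 M2 a i n)" for i n a
  let ?r = "complex_of_real (1 / sqrt 2)"
  have "(\<Sum>a\<le>L. of_real (recoupling L1 L2 L M1 M2 n1 n2 a) * pol L a u1 u2) =
     (\<Sum>a1\<le>L1. \<Sum>a2\<le>L2. S a1 a2 * (?r * (e 0 n1 a1 * f 1 n2 a2 - e 1 n1 a1 * f 0 n2 a2)))" for n1 n2
  proof -
    have "(\<Sum>a\<le>L. of_real (recoupling L1 L2 L M1 M2 n1 n2 a) * pol L a u1 u2) =
      (\<Sum>a\<le>L. \<Sum>a1\<le>L1. \<Sum>a2\<le>L2. of_real (cg L1 L2 L a1 a2 a) * pol L a u1 u2 *
        (?r * (e 0 n1 a1 * f 1 n2 a2 - e 1 n1 a1 * f 0 n2 a2)))"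
      unfolding recoupling_singlet of_real_sum sum_distrib_right e_def f_def
      by (intro sum.cong refl) simp
    also have "\<dots> = (\<Sum>a1\<le>L1. \<Sum>a2\<le>L2. \<Sum>a\<le>L. of_real (cg L1 L2 L a1 a2 a) * pol L a u1 u2 *
        (?r * (e 0 n1 a1 * f 1 n2 a2 - e 1 n1 a1 * f 0 n2 a2)))"
      by (subst sum.swap, rule sum.cong[OF refl], rule sum.swap)
    finally show ?thesis by (simp only: S_def sum_distrib_right)
  qed
  then have "(\<Sum>n1\<le>M1. \<Sum>n2\<le>M2. (\<Sum>a\<le>L. of_real (recoupling L1 L2 L M1 M2 n1 n2 a) * pol L a u1 u2) *
      (pol M1 n1 z1 z2 * pol M2 n2 w1 w2)) =
    (\<Sum>n1\<le>M1. \<Sum>n2\<le>M2. \<Sum>a1\<le>L1. \<Sum>a2\<le>L2. S a1 a2 * (?r * (e 0 n1 a1 * f 1 n2 a2 - e 1 n1 a1 * f 0 n2 a2)) *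
      (pol M1 n1 z1 z2 * pol M2 n2 w1 w2))"
    by (simp only: sum_distrib_right)
  also have "\<dots> = (\<Sum>a1\<le>L1. \<Sum>a2\<le>L2. \<Sum>n1\<le>M1. \<Sum>n2\<le>M2. S a1 a2 * (?r * (e 0 n1 a1 * f 1 n2 a2 - e 1 n1 a1 * f 0 n2 a2)) *
      (pol M1 n1 z1 z2 * pol M2 n2 w1 w2))"
    by (rule sum_swap_pairs)
  also have "\<dots> = (\<Sum>a1\<le>L1. \<Sum>a2\<le>L2. ?r * (S a1 a2 * ((\<Sum>n1\<le>M1. e 0 n1 a1 * pol M1 n1 z1 z2) * (\<Sum>n2\<le>M2. f 1 n2 a2 * pol M2 n2 w1 w2))) -
        ?r * (S a1 a2 * ((\<Sum>n1\<le>M1. e 1 n1 a1 * pol M1 n1 z1 z2) * (\<Sum>n2\<le>M2. f 0 n2 a2 * pol M2 n2 w1 w2))))"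
  proof (rule sum.cong[OF refl], rule sum.cong[OF refl])
    fix a1 a2
    have "(\<Sum>n1\<le>M1. \<Sum>n2\<le>M2. S a1 a2 * (?r * (e 0 n1 a1 * f 1 n2 a2 - e 1 n1 a1 * f 0 n2 a2)) *
        (pol M1 n1 z1 z2 * pol M2 n2 w1 w2)) =
      (\<Sum>n1\<le>M1. \<Sum>n2\<le>M2. ?r * (S a1 a2 * ((e 0 n1 a1 * pol M1 n1 z1 z2) * (f 1 n2 a2 * pol M2 n2 w1 w2))) -
        ?r * (S a1 a2 * ((e 1 n1 a1 * pol M1 n1 z1 z2) * (f 0 n2 a2 * pol M2 n2 w1 w2))))"
      by (intro sum.cong refl) (simp add: algebra_simps)
    also have "\<dots> = ?r * (S a1 a2 * ((\<Sum>n1\<le>M1. e 0 n1 a1 * pol M1 n1 z1 z2) * (\<Sum>n2\<le>M2. f 1 n2 a2 * pol M2 n2 w1 w2))) -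
        ?r * (S a1 a2 * ((\<Sum>n1\<le>M1. e 1 n1 a1 * pol M1 n1 z1 z2) * (\<Sum>n2\<le>M2. f 0 n2 a2 * pol M2 n2 w1 w2)))"
      by (simp only: sum_subtractf sum_distrib_left [symmetric] sum_distrib_right [symmetric])
    finally show "(\<Sum>n1\<le>M1. \<Sum>n2\<le>M2. S a1 a2 * (?r * (e 0 n1 a1 * f 1 n2 a2 - e 1 n1 a1 * f 0 n2 a2)) *
        (pol M1 n1 z1 z2 * pol M2 n2 w1 w2)) = \<dots>" .
  qed
  finally show ?thesis
    by (simp only: pairing_def S_def e_def f_def sum_subtractf sum_distrib_left right_diff_distrib)
qed

end

definition racah_form ::
    "nat \<Rightarrow> nat \<Rightarrow> nat \<Rightarrow> complex \<Rightarrow> complex \<Rightarrow> complex \<Rightarrow> complex \<Rightarrow> complex \<Rightarrow> complex \<Rightarrow> complex" where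
  "racah_form A B N u1 u2 z1 z2 w1 w2 =
     (z2 * w1 - z1 * w2) ^ N * (z1 * u1 + z2 * u2) ^ A * (w1 * u1 + w2 * u2) ^ B"

text \<open>Comparison of generating functions; the division by \<open>kappa A B N\<close> undoes the factor in the
  generating function of the target spins.\<close>

lemma recoupling_eq_multiple_cg:
  assumes "M1 = A + N" "M2 = B + N" "L = A + B"
    and "\<And>u1 u2 z1 z2 w1 w2. (\<Sum>n1\<le>M1. \<Sum>n2\<le>M2. (\<Sum>a\<le>L. of_real (recoupling L1 L2 L M1 M2 n1 n2 a) * pol L a u1 u2) *
      (pol M1 n1 z1 z2 * pol M2 n2 w1 w2)) = of_real C * racah_form A B N u1 u2 z1 z2 w1 w2"
    and "n1 \<le> M1" "n2 \<le> M2" "a \<le> L"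
  shows "recoupling L1 L2 L M1 M2 n1 n2 a = C / kappa A B N * cg M1 M2 L n1 n2 a"
proof -
  define c where "c = C / kappa A B N"
  have C: "C = c * kappa A B N" using kappa_pos[of A B N] by (simp add: c_def)
  have "complex_of_real (recoupling L1 L2 L M1 M2 n1 n2 a) = of_real (c * cg M1 M2 L n1 n2 a)"
  proof (rule pol_eq_iff3[OF _ assms(5-7)])
    fix z1 z2 w1 w2 u1 u2
    have "(\<Sum>n1\<le>M1. \<Sum>n2\<le>M2. \<Sum>a\<le>L. of_real (recoupling L1 L2 L M1 M2 n1 n2 a) * (pol M1 n1 z1 z2 * pol M2 n2 w1 w2 * pol L a u1 u2)) =
       of_real c * (of_real (kappa A B N) * racah_form A B N u1 u2 z1 z2 w1 w2)"
      using assms(4)[of u1 u2 z1 z2 w1 w2] unfolding C by (simp add: sum_distrib_left sum_distrib_right mult_ac)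
    also have "\<dots> = of_real c * (\<Sum>a1\<le>A + N. \<Sum>a2\<le>B + N. \<Sum>a\<le>A + B. of_real (cg (A + N) (B + N) (A + B) a1 a2 a) *
      (pol (A + N) a1 z1 z2 * pol (B + N) a2 w1 w2 * pol (A + B) a u1 u2))"
      unfolding racah_form_def racah_generating_function ..
    finally show "(\<Sum>n1\<le>M1. \<Sum>n2\<le>M2. \<Sum>a\<le>L. of_real (recoupling L1 L2 L M1 M2 n1 n2 a) * (pol M1 n1 z1 z2 * pol M2 n2 w1 w2 * pol L a u1 u2)) =
      (\<Sum>n1\<le>M1. \<Sum>n2\<le>M2. \<Sum>a\<le>L. of_real (c * cg M1 M2 L n1 n2 a) * (pol M1 n1 z1 z2 * pol M2 n2 w1 w2 * pol L a u1 u2))"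
      using assms(1-3) by (simp add: sum_distrib_left mult.assoc)
  qed
  then show ?thesis by (simp only: of_real_eq_iff c_def)
qed

lemma recoupling_eq_0:
  assumes "\<And>u1 u2 z1 z2 w1 w2. (\<Sum>n1\<le>M1. \<Sum>n2\<le>M2. (\<Sum>a\<le>L. of_real (recoupling L1 L2 L M1 M2 n1 n2 a) * pol L a u1 u2) *
      (pol M1 n1 z1 z2 * pol M2 n2 w1 w2)) = 0"
    and "n1 \<le> M1" "n2 \<le> M2" "a \<le> L"
  shows "recoupling L1 L2 L M1 M2 n1 n2 a = 0"
proof -
  have "complex_of_real (recoupling L1 L2 L M1 M2 n1 n2 a) = 0"
  proof (rule pol_eq_iff3[OF _ assms(2-4), where d = "\<lambda>_ _ _. 0"])
    fix z1 z2 w1 w2 u1 u2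
    show "(\<Sum>n1\<le>M1. \<Sum>n2\<le>M2. \<Sum>a\<le>L. of_real (recoupling L1 L2 L M1 M2 n1 n2 a) * (pol M1 n1 z1 z2 * pol M2 n2 w1 w2 * pol L a u1 u2)) =
      (\<Sum>n1\<le>M1. \<Sum>n2\<le>M2. \<Sum>a\<le>L. 0 * (pol M1 n1 z1 z2 * pol M2 n2 w1 w2 * pol L a u1 u2))"
      using assms(1)[of u1 u2 z1 z2 w1 w2] by (simp add: sum_distrib_left sum_distrib_right mult_ac)
  qed
  then show ?thesis by simp
qed

text \<open>The first two derivatives of \<open>x ^ n\<close>; as constants they satisfy identities without case
  distinctions on small \<open>n\<close>.\<close>

definition dpow :: "nat \<Rightarrow> complex \<Rightarrow> complex" where "dpow n x = of_nat n * x ^ (n - 1)"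
definition ddpow :: "nat \<Rightarrow> complex \<Rightarrow> complex" where "ddpow n x = of_nat n * (of_nat (n - 1) * x ^ (n - 2))"

lemma dpow_mult: "x * dpow n x = of_nat n * x ^ n"
  by (cases n) (simp_all add: dpow_def)

lemma ddpow_mult: "x * ddpow n x = (of_nat n - 1) * dpow n x"
proof (cases n)
  case (Suc m)
  then show ?thesis by (cases m) (simp_all add: dpow_def ddpow_def)
qed (simp add: dpow_def ddpow_def)

lemma DERIV_dpow:
  "(f has_field_derivative f') (at x) \<Longrightarrow> ((\<lambda>x. f x ^ n) has_field_derivative dpow n (f x) * f') (at x)"
  "(f has_field_derivative f') (at x) \<Longrightarrow> ((\<lambda>x. dpow n (f x)) has_field_derivative ddpow n (f x) * f') (at x)"
  unfolding dpow_def ddpow_def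
  by (auto intro!: derivative_eq_intros simp: numeral_2_eq_2)

lemma pairing_pol:
  "pairing (A + N) (B + N) (A + B) u1 u2 (\<lambda>a. pol (A + N) a z1 z2) (\<lambda>a. pol (B + N) a w1 w2) = of_real (kappa A B N) * racah_form A B N u1 u2 z1 z2 w1 w2"
  unfolding pairing_def racah_form_def by (rule racah_generating_function_contracted) simp_all

text \<open>This identity and its analogues up to \<open>pairing_dx_dy\<close> are partial derivatives of the generating
  function, identified by uniqueness of derivatives.\<close>

lemma pairing_pol_dx:
  "pairing (A + N) (B + N) (A + B) u1 u2 (\<lambda>a. pol (A + N) a z1 z2) (\<lambda>a. pol_dx (B + N) a w1 w2) = of_real (kappa A B N) *
     (z2 * dpow N (z2 * w1 - z1 * w2) * (z1 * u1 + z2 * u2) ^ A * (w1 * u1 + w2 * u2) ^ B +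
      u1 * (z2 * w1 - z1 * w2) ^ N * (z1 * u1 + z2 * u2) ^ A * dpow B (w1 * u1 + w2 * u2))"
  by (rule DERIV_unique[OF DERIV_pairing_right[OF DERIV_pol_x]], unfold pairing_pol racah_form_def)
    (auto intro!: derivative_eq_intros DERIV_dpow simp: dpow_def ddpow_def numeral_2_eq_2 algebra_simps)

lemma pairing_pol_dy:
  "pairing (A + N) (B + N) (A + B) u1 u2 (\<lambda>a. pol (A + N) a z1 z2) (\<lambda>a. pol_dy (B + N) a w1 w2) = of_real (kappa A B N) *
     (- z1 * dpow N (z2 * w1 - z1 * w2) * (z1 * u1 + z2 * u2) ^ A * (w1 * u1 + w2 * u2) ^ B +
      u2 * (z2 * w1 - z1 * w2) ^ N * (z1 * u1 + z2 * u2) ^ A * dpow B (w1 * u1 + w2 * u2))"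
  by (rule DERIV_unique[OF DERIV_pairing_right[OF DERIV_pol_y]], unfold pairing_pol racah_form_def)
    (auto intro!: derivative_eq_intros DERIV_dpow simp: dpow_def ddpow_def numeral_2_eq_2 algebra_simps)

lemma pairing_dx_pol:
  "pairing (A + N) (B + N) (A + B) u1 u2 (\<lambda>a. pol_dx (A + N) a z1 z2) (\<lambda>a. pol (B + N) a w1 w2) = of_real (kappa A B N) *
     (- w2 * dpow N (z2 * w1 - z1 * w2) * (z1 * u1 + z2 * u2) ^ A * (w1 * u1 + w2 * u2) ^ B +
      u1 * (z2 * w1 - z1 * w2) ^ N * dpow A (z1 * u1 + z2 * u2) * (w1 * u1 + w2 * u2) ^ B)"
  by (rule DERIV_unique[OF DERIV_pairing_left[OF DERIV_pol_x]], unfold pairing_pol racah_form_def)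
    (auto intro!: derivative_eq_intros DERIV_dpow simp: dpow_def ddpow_def numeral_2_eq_2 algebra_simps)

lemma pairing_dy_pol:
  "pairing (A + N) (B + N) (A + B) u1 u2 (\<lambda>a. pol_dy (A + N) a z1 z2) (\<lambda>a. pol (B + N) a w1 w2) = of_real (kappa A B N) *
     (w1 * dpow N (z2 * w1 - z1 * w2) * (z1 * u1 + z2 * u2) ^ A * (w1 * u1 + w2 * u2) ^ B +
      u2 * (z2 * w1 - z1 * w2) ^ N * dpow A (z1 * u1 + z2 * u2) * (w1 * u1 + w2 * u2) ^ B)"
  by (rule DERIV_unique[OF DERIV_pairing_left[OF DERIV_pol_y]], unfold pairing_pol racah_form_def)
    (auto intro!: derivative_eq_intros DERIV_dpow simp: dpow_def ddpow_def numeral_2_eq_2 algebra_simps)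

lemma pairing_dy_dx:
  "pairing (A + N) (B + N) (A + B) u1 u2 (\<lambda>a. pol_dy (A + N) a z1 z2) (\<lambda>a. pol_dx (B + N) a w1 w2) = of_real (kappa A B N) *
     (dpow N (z2 * w1 - z1 * w2) * (z1 * u1 + z2 * u2) ^ A * (w1 * u1 + w2 * u2) ^ B +
      z2 * w1 * ddpow N (z2 * w1 - z1 * w2) * (z1 * u1 + z2 * u2) ^ A * (w1 * u1 + w2 * u2) ^ B +
      z2 * u2 * dpow N (z2 * w1 - z1 * w2) * dpow A (z1 * u1 + z2 * u2) * (w1 * u1 + w2 * u2) ^ B +
      u1 * w1 * dpow N (z2 * w1 - z1 * w2) * (z1 * u1 + z2 * u2) ^ A * dpow B (w1 * u1 + w2 * u2) +
      u1 * u2 * (z2 * w1 - z1 * w2) ^ N * dpow A (z1 * u1 + z2 * u2) * dpow B (w1 * u1 + w2 * u2))"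
  by (rule DERIV_unique[OF DERIV_pairing_left[OF DERIV_pol_y]], unfold pairing_pol_dx)
    (auto intro!: derivative_eq_intros DERIV_dpow simp: dpow_def ddpow_def numeral_2_eq_2 algebra_simps)

lemma pairing_dx_dy:
  "pairing (A + N) (B + N) (A + B) u1 u2 (\<lambda>a. pol_dx (A + N) a z1 z2) (\<lambda>a. pol_dy (B + N) a w1 w2) = of_real (kappa A B N) *
     (- dpow N (z2 * w1 - z1 * w2) * (z1 * u1 + z2 * u2) ^ A * (w1 * u1 + w2 * u2) ^ B +
      z1 * w2 * ddpow N (z2 * w1 - z1 * w2) * (z1 * u1 + z2 * u2) ^ A * (w1 * u1 + w2 * u2) ^ B -
      z1 * u1 * dpow N (z2 * w1 - z1 * w2) * dpow A (z1 * u1 + z2 * u2) * (w1 * u1 + w2 * u2) ^ B -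
      u2 * w2 * dpow N (z2 * w1 - z1 * w2) * (z1 * u1 + z2 * u2) ^ A * dpow B (w1 * u1 + w2 * u2) +
      u1 * u2 * (z2 * w1 - z1 * w2) ^ N * dpow A (z1 * u1 + z2 * u2) * dpow B (w1 * u1 + w2 * u2))"
  by (rule DERIV_unique[OF DERIV_pairing_left[OF DERIV_pol_x]], unfold pairing_pol_dy)
    (auto intro!: derivative_eq_intros DERIV_dpow simp: dpow_def ddpow_def numeral_2_eq_2 algebra_simps)

lemma pol_1 [simp]: "pol 1 0 x y = y" "pol 1 (Suc 0) x y = x" "pol (Suc 0) 0 x y = y" "pol (Suc 0) (Suc 0) x y = x"
  by (simp_all add: pol_def)

lemma pairing_half_plus_left:
  assumes "i \<le> 1"
  shows "pairing L1 L2 L u1 u2 (\<lambda>a. \<Sum>n\<le>L1 + 1. of_real (cg L1 1 (L1 + 1) a i n) * pol (L1 + 1) n z1 z2) Y =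
    pol 1 i z1 z2 * pairing L1 L2 L u1 u2 (\<lambda>a. pol L1 a z1 z2) Y"
  unfolding pairing_scale_left [symmetric] using assms
  by (intro pairing_cong refl) (subst cg_half_plus_pol; simp add: mult.commute)

lemma pairing_half_plus_right:
  assumes "i \<le> 1"
  shows "pairing L1 L2 L u1 u2 X (\<lambda>a. \<Sum>n\<le>L2 + 1. of_real (cg L2 1 (L2 + 1) a i n) * pol (L2 + 1) n w1 w2) =
    pol 1 i w1 w2 * pairing L1 L2 L u1 u2 X (\<lambda>a. pol L2 a w1 w2)"
  unfolding pairing_scale_right [symmetric] using assms
  by (intro pairing_cong refl) (subst cg_half_plus_pol; simp add: mult.commute)

text \<open>The factor in \<open>cg_half_minus_pol\<close>.\<close>

abbreviation "lower_const M \<equiv> kappa M 0 1 / real (M + 1)"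

lemma pairing_half_minus_left:
  assumes "L1 = M + 1"
  shows "pairing L1 L2 L u1 u2 (\<lambda>a. \<Sum>n\<le>M. of_real (cg L1 1 M a 0 n) * pol M n z1 z2) Y =
      of_real (- lower_const M) * pairing L1 L2 L u1 u2 (\<lambda>a. pol_dx L1 a z1 z2) Y"
    and "pairing L1 L2 L u1 u2 (\<lambda>a. \<Sum>n\<le>M. of_real (cg L1 1 M a 1 n) * pol M n z1 z2) Y =
      of_real (lower_const M) * pairing L1 L2 L u1 u2 (\<lambda>a. pol_dy L1 a z1 z2) Y"
  unfolding pairing_scale_left [symmetric] assms
  by (intro pairing_cong refl, subst cg_half_minus_pol; simp)+

lemma pairing_half_minus_right:
  assumes "L2 = M + 1"
  shows "pairing L1 L2 L u1 u2 X (\<lambda>a. \<Sum>n\<le>M. of_real (cg L2 1 M a 0 n) * pol M n w1 w2) =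
      of_real (- lower_const M) * pairing L1 L2 L u1 u2 X (\<lambda>a. pol_dx L2 a w1 w2)"
    and "pairing L1 L2 L u1 u2 X (\<lambda>a. \<Sum>n\<le>M. of_real (cg L2 1 M a 1 n) * pol M n w1 w2) =
      of_real (lower_const M) * pairing L1 L2 L u1 u2 X (\<lambda>a. pol_dy L2 a w1 w2)"
  unfolding pairing_scale_right [symmetric] assms
  by (intro pairing_cong refl, subst cg_half_minus_pol; simp)+

text \<open>Both spins go up: the generating function is multiplied by \<open>[z, w] / sqrt 2\<close>.\<close>

lemma recoupling_raise_raise:
  assumes "n1 \<le> A + N + 1" "n2 \<le> B + N + 1" "a \<le> A + B"
  shows "recoupling (A + N) (B + N) (A + B) (A + N + 1) (B + N + 1) n1 n2 a =
    kappa A B N / sqrt 2 / kappa A B (N + 1) * cg (A + N + 1) (B + N + 1) (A + B) n1 n2 a"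
proof (rule recoupling_eq_multiple_cg[OF _ _ refl _ assms])
  fix u1 u2 z1 z2 w1 w2
  show "(\<Sum>n1\<le>A + N + 1. \<Sum>n2\<le>B + N + 1. (\<Sum>a\<le>A + B.
        of_real (recoupling (A + N) (B + N) (A + B) (A + N + 1) (B + N + 1) n1 n2 a) * pol (A + B) a u1 u2) *
      (pol (A + N + 1) n1 z1 z2 * pol (B + N + 1) n2 w1 w2)) =
    of_real (kappa A B N / sqrt 2) * racah_form A B (N + 1) u1 u2 z1 z2 w1 w2"
    unfolding recoupling_generating_function pairing_half_plus_left[OF le0] pairing_half_plus_right[OF le0]
      pairing_half_plus_left[OF le_refl] pairing_half_plus_right[OF le_refl] pairing_pol
    by (simp add: racah_form_def algebra_simps)
qed simp_all

text \<open>The polarisation \<open>z2 * \<partial>\<^sub>w\<^sub>2 + z1 * \<partial>\<^sub>w\<^sub>1\<close> kills \<open>[z, w]\<close> and sends \<open>w \<bullet> u\<close> to \<open>z \<bullet> u\<close>.  For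
  \<open>B = 0\<close> the result vanishes, and the target triple violates the triangle inequality.\<close>

lemma recoupling_raise_lower:
  assumes "B + N = M + 1"
  shows "\<exists>c. \<forall>n1\<le>A + N + 1. \<forall>n2\<le>M. \<forall>a\<le>A + B.
    recoupling (A + N) (B + N) (A + B) (A + N + 1) M n1 n2 a = c * cg (A + N + 1) M (A + B) n1 n2 a"
proof -
  have g: "(\<Sum>n1\<le>A + N + 1. \<Sum>n2\<le>M. (\<Sum>a\<le>A + B.
        of_real (recoupling (A + N) (B + N) (A + B) (A + N + 1) M n1 n2 a) * pol (A + B) a u1 u2) *
      (pol (A + N + 1) n1 z1 z2 * pol M n2 w1 w2)) =
    of_real (1 / sqrt 2) * of_real (lower_const M) * of_real (kappa A B N) *
      ((z2 * w1 - z1 * w2) ^ N * (z1 * u1 + z2 * u2) ^ (A + 1) * dpow B (w1 * u1 + w2 * u2))" for u1 u2 z1 z2 w1 w2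
    unfolding recoupling_generating_function pairing_half_plus_left[OF le0] pairing_half_minus_right[OF assms]
      pairing_half_plus_left[OF le_refl] pairing_pol_dx pairing_pol_dy
    by (simp add: algebra_simps del: of_real_divide of_real_mult)
  show ?thesis
  proof (cases B)
    case 0
    have "recoupling (A + N) (B + N) (A + B) (A + N + 1) M n1 n2 a = 0"
      if "n1 \<le> A + N + 1" "n2 \<le> M" "a \<le> A + B" for n1 n2 a
      by (rule recoupling_eq_0[OF _ that], subst g) (simp add: 0 dpow_def)
    then show ?thesis by (intro exI[of _ 0]) simp
  next
    case (Suc B')
    have "recoupling (A + N) (B + N) (A + B) (A + N + 1) M n1 n2 a =
      (1 / sqrt 2 * lower_const M * kappa A B N * real B) / kappa (A + 1) B' N * cg (A + N + 1) M (A + B) n1 n2 a"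
      if "n1 \<le> A + N + 1" "n2 \<le> M" "a \<le> A + B" for n1 n2 a
      by (rule recoupling_eq_multiple_cg[OF _ _ _ _ that], use assms Suc in simp, use assms Suc in simp,
          use assms Suc in simp, subst g) (simp add: racah_form_def dpow_def Suc)
    then show ?thesis by blast
  qed
qed

text \<open>The mirror image of the previous case, with the polarisation \<open>w1 * \<partial>\<^sub>z\<^sub>1 + w2 * \<partial>\<^sub>z\<^sub>2\<close>.\<close>

lemma recoupling_lower_raise:
  assumes "A + N = M + 1"
  shows "\<exists>c. \<forall>n1\<le>M. \<forall>n2\<le>B + N + 1. \<forall>a\<le>A + B.
    recoupling (A + N) (B + N) (A + B) M (B + N + 1) n1 n2 a = c * cg M (B + N + 1) (A + B) n1 n2 a"
proof -
  have g: "(\<Sum>n1\<le>M. \<Sum>n2\<le>B + N + 1. (\<Sum>a\<le>A + B.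
        of_real (recoupling (A + N) (B + N) (A + B) M (B + N + 1) n1 n2 a) * pol (A + B) a u1 u2) *
      (pol M n1 z1 z2 * pol (B + N + 1) n2 w1 w2)) =
    - (of_real (1 / sqrt 2) * of_real (lower_const M) * of_real (kappa A B N) *
      ((z2 * w1 - z1 * w2) ^ N * dpow A (z1 * u1 + z2 * u2) * (w1 * u1 + w2 * u2) ^ (B + 1)))" for u1 u2 z1 z2 w1 w2
    unfolding recoupling_generating_function pairing_half_plus_right[OF le0] pairing_half_minus_left[OF assms]
      pairing_half_plus_right[OF le_refl] pairing_dx_pol pairing_dy_pol
    by (simp add: algebra_simps del: of_real_divide of_real_mult)
  show ?thesis
  proof (cases A)
    case 0
    have "recoupling (A + N) (B + N) (A + B) M (B + N + 1) n1 n2 a = 0"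
      if "n1 \<le> M" "n2 \<le> B + N + 1" "a \<le> A + B" for n1 n2 a
      by (rule recoupling_eq_0[OF _ that], subst g) (simp add: 0 dpow_def)
    then show ?thesis by (intro exI[of _ 0]) simp
  next
    case (Suc A')
    have "recoupling (A + N) (B + N) (A + B) M (B + N + 1) n1 n2 a =
      (- (1 / sqrt 2 * lower_const M * kappa A B N * real A)) / kappa A' (B + 1) N * cg M (B + N + 1) (A + B) n1 n2 a"
      if "n1 \<le> M" "n2 \<le> B + N + 1" "a \<le> A + B" for n1 n2 a
      by (rule recoupling_eq_multiple_cg[OF _ _ _ _ that], use assms Suc in simp, use assms Suc in simp,
          use assms Suc in simp, subst g) (simp add: racah_form_def dpow_def Suc)
    then show ?thesis by blast
  qed
qed

text \<open>Cayley's operator: by Euler's identities it sends \<open>[z, w]\<^sup>N * (z \<bullet> u)\<^sup>A * (w \<bullet> u)\<^sup>B\<close> to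
  \<open>N * (N + A + B + 1)\<close> times the same expression with \<open>N - 1\<close> in place of \<open>N\<close>.\<close>

lemma recoupling_lower_lower:
  assumes "A + N = M1 + 1" "B + N = M2 + 1"
  shows "\<exists>c. \<forall>n1\<le>M1. \<forall>n2\<le>M2. \<forall>a\<le>A + B.
    recoupling (A + N) (B + N) (A + B) M1 M2 n1 n2 a = c * cg M1 M2 (A + B) n1 n2 a"
proof -
  have g: "(\<Sum>n1\<le>M1. \<Sum>n2\<le>M2. (\<Sum>a\<le>A + B.
        of_real (recoupling (A + N) (B + N) (A + B) M1 M2 n1 n2 a) * pol (A + B) a u1 u2) *
      (pol M1 n1 z1 z2 * pol M2 n2 w1 w2)) =
    of_real (1 / sqrt 2) * of_real (lower_const M1) * of_real (lower_const M2) * of_real (kappa A B N) *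
      of_nat (N + A + B + 1) *
      (dpow N (z2 * w1 - z1 * w2) * (z1 * u1 + z2 * u2) ^ A * (w1 * u1 + w2 * u2) ^ B)" for u1 u2 z1 z2 w1 w2
  proof -
    let ?g = "z2 * w1 - z1 * w2" and ?p = "z1 * u1 + z2 * u2" and ?q = "w1 * u1 + w2 * u2"
    have "pairing (A + N) (B + N) (A + B) u1 u2 (\<lambda>a. pol_dy (A + N) a z1 z2) (\<lambda>a. pol_dx (B + N) a w1 w2) -
        pairing (A + N) (B + N) (A + B) u1 u2 (\<lambda>a. pol_dx (A + N) a z1 z2) (\<lambda>a. pol_dy (B + N) a w1 w2) =
      of_real (kappa A B N) * (2 * dpow N ?g * ?p ^ A * ?q ^ B + (?g * ddpow N ?g) * ?p ^ A * ?q ^ B +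
        dpow N ?g * (?p * dpow A ?p) * ?q ^ B + dpow N ?g * ?p ^ A * (?q * dpow B ?q))"
      unfolding pairing_dx_dy pairing_dy_dx by (simp add: algebra_simps)
    also have "\<dots> = of_real (kappa A B N) * (of_nat (N + A + B + 1) * (dpow N ?g * ?p ^ A * ?q ^ B))"
      unfolding dpow_mult ddpow_mult by (simp add: algebra_simps)
    finally have P: "pairing (A + N) (B + N) (A + B) u1 u2 (\<lambda>a. pol_dy (A + N) a z1 z2) (\<lambda>a. pol_dx (B + N) a w1 w2) =
        pairing (A + N) (B + N) (A + B) u1 u2 (\<lambda>a. pol_dx (A + N) a z1 z2) (\<lambda>a. pol_dy (B + N) a w1 w2) +
        of_real (kappa A B N) * (of_nat (N + A + B + 1) * (dpow N ?g * ?p ^ A * ?q ^ B))"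
      by (simp only: diff_eq_eq add.commute)
    show ?thesis
      unfolding recoupling_generating_function pairing_half_minus_left[OF assms(1)] pairing_half_minus_right[OF assms(2)] P
      by (simp add: algebra_simps del: of_real_divide of_real_mult)
  qed
  show ?thesis
  proof (cases N)
    case 0
    have "recoupling (A + N) (B + N) (A + B) M1 M2 n1 n2 a = 0"
      if "n1 \<le> M1" "n2 \<le> M2" "a \<le> A + B" for n1 n2 a
      by (rule recoupling_eq_0[OF _ that], subst g) (simp add: 0 dpow_def)
    then show ?thesis by (intro exI[of _ 0]) simp
  next
    case (Suc N')
    have "recoupling (A + N) (B + N) (A + B) M1 M2 n1 n2 a =
      (1 / sqrt 2 * lower_const M1 * lower_const M2 * kappa A B N * real (N + A + B + 1) * real N) /
        kappa A B N' * cg M1 M2 (A + B) n1 n2 a"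
      if "n1 \<le> M1" "n2 \<le> M2" "a \<le> A + B" for n1 n2 a
      by (rule recoupling_eq_multiple_cg[OF _ _ _ _ that], use assms Suc in simp, use assms Suc in simp,
          use assms Suc in simp, subst g) (simp add: racah_form_def dpow_def Suc)
    then show ?thesis by blast
  qed
qed

text \<open>This takes the place of Schur's lemma: the part \<open>(M1, M2)\<close> contains the spin \<open>L/2\<close> at most once.\<close>

lemma recoupling_proportional:
  assumes "L1 = A + N" "L2 = B + N" "L = A + B" "M1 \<in> half_spins L1" "M2 \<in> half_spins L2"
  shows "\<exists>c. \<forall>n1\<le>M1. \<forall>n2\<le>M2. \<forall>a\<le>L. recoupling L1 L2 L M1 M2 n1 n2 a = c * cg M1 M2 L n1 n2 a"
proof -
  have h: "M = L' + 1 \<or> L' = M + 1" if "M \<in> half_spins L'" for M L'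
    using that by (auto simp: half_spins_def split: if_splits)
  consider "M1 = L1 + 1" "M2 = L2 + 1" | "M1 = L1 + 1" "L2 = M2 + 1" |
    "L1 = M1 + 1" "M2 = L2 + 1" | "L1 = M1 + 1" "L2 = M2 + 1"
    using h[OF assms(4)] h[OF assms(5)] by blast
  then show ?thesis
  proof cases
    case 1
    then show ?thesis unfolding assms(1-3) using recoupling_raise_raise by blast
  next
    case 2
    then show ?thesis using recoupling_raise_lower[of B N M2 A] by (simp only: assms(1-3))
  next
    case 3
    then show ?thesis using recoupling_lower_raise[of A N M1 B] by (simp only: assms(1-3))
  next
    case 4
    then show ?thesis using recoupling_lower_lower[of A N M1 B M2] by (simp only: assms(1-3))
  qed
qed

section \<open>Products of matrices of spherical functions\<close>

text \<open>The matrix of \<open>Phi\<close> in the basis \<open>psi\<close>; pairs of indices are summed as one variable because all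
  rearrangements below exchange such pairs.\<close>

definition spherical_mat :: "nat \<Rightarrow> nat \<Rightarrow> nat \<Rightarrow> mat2 \<Rightarrow> mat2 \<Rightarrow> nat \<Rightarrow> nat \<Rightarrow> complex" where
  "spherical_mat L1 L2 L k1 k2 a' a = (\<Sum>\<alpha>\<in>{..L1} \<times> {..L2}. \<Sum>\<alpha>'\<in>{..L1} \<times> {..L2}.
     of_real (cg L1 L2 L (fst \<alpha>) (snd \<alpha>) a * cg L1 L2 L (fst \<alpha>') (snd \<alpha>') a') *
     (tmat k1 L1 (fst \<alpha>') (fst \<alpha>) * tmat k2 L2 (snd \<alpha>') (snd \<alpha>)))"

text \<open>The index set of the double Clebsch-Gordan series: the two target spins together with the weights
  of the source and of the target vector.\<close>

definition channels :: "nat \<Rightarrow> nat \<Rightarrow> ((nat \<times> nat) \<times> (nat \<times> nat) \<times> nat \<times> nat) set" where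
  "channels L1 L2 = Sigma (half_spins L1 \<times> half_spins L2)
     (\<lambda>M. ({..fst M} \<times> {..snd M}) \<times> ({..fst M} \<times> {..snd M}))"

lemma sum_channels:
  "(\<Sum>y\<in>channels L1 L2. F (fst (fst y)) (snd (fst y)) (fst (snd y)) (snd (snd y))) =
   (\<Sum>M1\<in>half_spins L1. \<Sum>M2\<in>half_spins L2. \<Sum>\<nu>\<in>{..M1} \<times> {..M2}. \<Sum>\<nu>'\<in>{..M1} \<times> {..M2}. F M1 M2 \<nu> \<nu>')"
proof -
  have "(\<Sum>M1\<in>half_spins L1. \<Sum>M2\<in>half_spins L2. \<Sum>\<nu>\<in>{..M1} \<times> {..M2}. \<Sum>\<nu>'\<in>{..M1} \<times> {..M2}. F M1 M2 \<nu> \<nu>') =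
     (\<Sum>M\<in>half_spins L1 \<times> half_spins L2. \<Sum>\<nu>\<in>{..fst M} \<times> {..snd M}. \<Sum>\<nu>'\<in>{..fst M} \<times> {..snd M}. F (fst M) (snd M) \<nu> \<nu>')"
    by (rule sum_pair)
  also have "\<dots> = (\<Sum>M\<in>half_spins L1 \<times> half_spins L2. \<Sum>\<mu>\<in>({..fst M} \<times> {..snd M}) \<times> ({..fst M} \<times> {..snd M}).
      F (fst M) (snd M) (fst \<mu>) (snd \<mu>))"
    by (rule sum.cong[OF refl], rule sum_pair)
  also have "\<dots> = (\<Sum>y\<in>channels L1 L2. F (fst (fst y)) (snd (fst y)) (fst (snd y)) (snd (snd y)))"
    unfolding channels_def by (subst sum.Sigma) (auto simp: split_def)
  finally show ?thesis ..
qed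

lemma tmat_product_channels:
  assumes "det k1 = 1" "det k2 = 1" "a1 \<le> L1" "i1 \<le> 1" "a1' \<le> L1" "i1' \<le> 1"
    "a2 \<le> L2" "i2 \<le> 1" "a2' \<le> L2" "i2' \<le> 1"
  shows "(tmat k1 L1 a1' a1 * tmat k1 1 i1' i1) * (tmat k2 L2 a2' a2 * tmat k2 1 i2' i2) =
    (\<Sum>M1\<in>half_spins L1. \<Sum>M2\<in>half_spins L2. \<Sum>\<nu>\<in>{..M1} \<times> {..M2}. \<Sum>\<nu>'\<in>{..M1} \<times> {..M2}.
       (tmat k1 M1 (fst \<nu>') (fst \<nu>) * tmat k2 M2 (snd \<nu>') (snd \<nu>)) *
       (of_real (cg L1 1 M1 a1 i1 (fst \<nu>) * cg L2 1 M2 a2 i2 (snd \<nu>)) *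
        of_real (cg L1 1 M1 a1' i1' (fst \<nu>') * cg L2 1 M2 a2' i2' (snd \<nu>'))))"
proof -
  define e where "e M n n' = of_real (cg L1 1 M a1 i1 n * cg L1 1 M a1' i1' n') * tmat k1 M n' n" for M n n'
  define f where "f M n n' = of_real (cg L2 1 M a2 i2 n * cg L2 1 M a2' i2' n') * tmat k2 M n' n" for M n n'
  have "(tmat k1 L1 a1' a1 * tmat k1 1 i1' i1) * (tmat k2 L2 a2' a2 * tmat k2 1 i2' i2) =
     (\<Sum>M1\<in>half_spins L1. \<Sum>M2\<in>half_spins L2.
       (\<Sum>n1\<le>M1. \<Sum>n1'\<le>M1. e M1 n1 n1') * (\<Sum>n2\<le>M2. \<Sum>n2'\<le>M2. f M2 n2 n2'))"
    using clebsch_gordan_series_half[OF assms(1,3-6)] clebsch_gordan_series_half[OF assms(2,7-10)]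
    by (simp only: e_def f_def sum_product)
  also have "\<dots> = (\<Sum>M1\<in>half_spins L1. \<Sum>M2\<in>half_spins L2. \<Sum>\<nu>\<in>{..M1} \<times> {..M2}. \<Sum>\<nu>'\<in>{..M1} \<times> {..M2}.
      e M1 (fst \<nu>) (fst \<nu>') * f M2 (snd \<nu>) (snd \<nu>'))"
  proof (rule sum.cong[OF refl], rule sum.cong[OF refl])
    fix M1 M2
    have "(\<Sum>n1\<le>M1. \<Sum>n1'\<le>M1. e M1 n1 n1') * (\<Sum>n2\<le>M2. \<Sum>n2'\<le>M2. f M2 n2 n2') =
       (\<Sum>n1\<le>M1. \<Sum>n2\<le>M2. \<Sum>n1'\<le>M1. \<Sum>n2'\<le>M2. e M1 n1 n1' * f M2 n2 n2')"
      by (simp only: sum_distrib_left [symmetric] sum_distrib_right [symmetric])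
    also have "\<dots> = (\<Sum>\<nu>\<in>{..M1} \<times> {..M2}. \<Sum>n1'\<le>M1. \<Sum>n2'\<le>M2. e M1 (fst \<nu>) n1' * f M2 (snd \<nu>) n2')"
      by (rule sum_pair)
    also have "\<dots> = (\<Sum>\<nu>\<in>{..M1} \<times> {..M2}. \<Sum>\<nu>'\<in>{..M1} \<times> {..M2}. e M1 (fst \<nu>) (fst \<nu>') * f M2 (snd \<nu>) (snd \<nu>'))"
      by (rule sum.cong[OF refl], rule sum_pair)
    finally show "(\<Sum>n1\<le>M1. \<Sum>n1'\<le>M1. e M1 n1 n1') * (\<Sum>n2\<le>M2. \<Sum>n2'\<le>M2. f M2 n2 n2') = \<dots>" .
  qed
  finally show ?thesis by (simp only: e_def f_def of_real_mult mult_ac)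
qed

lemma recoupling_pairs:
  "recoupling L1 L2 L M1 M2 n1 n2 a = (\<Sum>\<alpha>\<in>{..L1} \<times> {..L2}. \<Sum>\<iota>\<in>{..1} \<times> {..1}.
     cg L1 L2 L (fst \<alpha>) (snd \<alpha>) a * cg 1 1 0 (fst \<iota>) (snd \<iota>) 0 *
     (cg L1 1 M1 (fst \<alpha>) (fst \<iota>) n1 * cg L2 1 M2 (snd \<alpha>) (snd \<iota>) n2))"
  unfolding recoupling_def mult.assoc by (rule sum_pairs)

lemma spherical_mat_product:
  assumes "det k1 = 1" "det k2 = 1"
  shows "spherical_mat 1 1 0 k1 k2 0 0 * spherical_mat L1 L2 L k1 k2 a' a =
    (\<Sum>M1\<in>half_spins L1. \<Sum>M2\<in>half_spins L2. \<Sum>\<nu>\<in>{..M1} \<times> {..M2}. \<Sum>\<nu>'\<in>{..M1} \<times> {..M2}.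
       (tmat k1 M1 (fst \<nu>') (fst \<nu>) * tmat k2 M2 (snd \<nu>') (snd \<nu>)) *
       (of_real (recoupling L1 L2 L M1 M2 (fst \<nu>) (snd \<nu>) a) * of_real (recoupling L1 L2 L M1 M2 (fst \<nu>') (snd \<nu>') a')))"
proof -
  let ?A = "{..L1} \<times> {..L2}" and ?I = "{..1::nat} \<times> {..1::nat}" and ?Y = "channels L1 L2"
  define V where "V b \<alpha> \<iota> = complex_of_real (cg L1 L2 L (fst \<alpha>) (snd \<alpha>) b * cg 1 1 0 (fst \<iota>) (snd \<iota>) 0)" for b and \<alpha> \<iota> :: "nat \<times> nat"
  define G where "G M1 M2 \<nu> \<alpha> \<iota> = complex_of_real (cg L1 1 M1 (fst \<alpha>) (fst \<iota>) (fst \<nu>) * cg L2 1 M2 (snd \<alpha>) (snd \<iota>) (snd \<nu>))"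
    for M1 M2 :: nat and \<nu> \<alpha> \<iota> :: "nat \<times> nat"
  define R where "R M1 M2 \<nu> \<nu>' = tmat k1 M1 (fst \<nu>') (fst \<nu>) * tmat k2 M2 (snd \<nu>') (snd \<nu>)" for M1 M2 and \<nu> \<nu>' :: "nat \<times> nat"
  define t where "t \<alpha> \<alpha>' \<iota> \<iota>' = (tmat k1 L1 (fst \<alpha>') (fst \<alpha>) * tmat k1 1 (fst \<iota>') (fst \<iota>)) *
      (tmat k2 L2 (snd \<alpha>') (snd \<alpha>) * tmat k2 1 (snd \<iota>') (snd \<iota>))" for \<alpha> \<alpha>' \<iota> \<iota>' :: "nat \<times> nat"
  have "spherical_mat 1 1 0 k1 k2 0 0 * spherical_mat L1 L2 L k1 k2 a' a =
     (\<Sum>\<alpha>\<in>?A. \<Sum>\<alpha>'\<in>?A. \<Sum>\<iota>\<in>?I. \<Sum>\<iota>'\<in>?I. V a \<alpha> \<iota> * V a' \<alpha>' \<iota>' * t \<alpha> \<alpha>' \<iota> \<iota>')"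
    by (subst mult.commute, unfold spherical_mat_def sum_product_double V_def t_def, intro sum.cong refl)
      (simp only: of_real_mult mult_ac)
  also have "\<dots> = (\<Sum>\<alpha>\<in>?A. \<Sum>\<iota>\<in>?I. \<Sum>\<alpha>'\<in>?A. \<Sum>\<iota>'\<in>?I. V a \<alpha> \<iota> * V a' \<alpha>' \<iota>' * t \<alpha> \<alpha>' \<iota> \<iota>')"
    by (rule sum.cong[OF refl], rule sum.swap)
  also have "\<dots> = (\<Sum>\<alpha>\<in>?A. \<Sum>\<iota>\<in>?I. \<Sum>\<alpha>'\<in>?A. \<Sum>\<iota>'\<in>?I. \<Sum>y\<in>?Y.
      R (fst (fst y)) (snd (fst y)) (fst (snd y)) (snd (snd y)) *
      ((V a \<alpha> \<iota> * G (fst (fst y)) (snd (fst y)) (fst (snd y)) \<alpha> \<iota>) *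
       (V a' \<alpha>' \<iota>' * G (fst (fst y)) (snd (fst y)) (snd (snd y)) \<alpha>' \<iota>')))"
  proof (intro sum.cong refl, goal_cases)
    case (1 \<alpha> \<iota> \<alpha>' \<iota>')
    have "t \<alpha> \<alpha>' \<iota> \<iota>' = (\<Sum>y\<in>?Y. R (fst (fst y)) (snd (fst y)) (fst (snd y)) (snd (snd y)) *
      (G (fst (fst y)) (snd (fst y)) (fst (snd y)) \<alpha> \<iota> * G (fst (fst y)) (snd (fst y)) (snd (snd y)) \<alpha>' \<iota>'))"
      unfolding t_def R_def G_def
      by (subst tmat_product_channels, use 1 assms in \<open>auto\<close>)
        (rule sum_channels [symmetric])
    then show ?case by (simp only: sum_distrib_left mult_ac)
  qed
  also have "\<dots> = (\<Sum>y\<in>?Y. R (fst (fst y)) (snd (fst y)) (fst (snd y)) (snd (snd y)) *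
      ((\<Sum>\<alpha>\<in>?A. \<Sum>\<iota>\<in>?I. V a \<alpha> \<iota> * G (fst (fst y)) (snd (fst y)) (fst (snd y)) \<alpha> \<iota>) *
       (\<Sum>\<alpha>'\<in>?A. \<Sum>\<iota>'\<in>?I. V a' \<alpha>' \<iota>' * G (fst (fst y)) (snd (fst y)) (snd (snd y)) \<alpha>' \<iota>')))"
    by (rule sum_bilinear_expansion)
  also have "\<dots> = (\<Sum>M1\<in>half_spins L1. \<Sum>M2\<in>half_spins L2. \<Sum>\<nu>\<in>{..M1} \<times> {..M2}. \<Sum>\<nu>'\<in>{..M1} \<times> {..M2}.
      R M1 M2 \<nu> \<nu>' * ((\<Sum>\<alpha>\<in>?A. \<Sum>\<iota>\<in>?I. V a \<alpha> \<iota> * G M1 M2 \<nu> \<alpha> \<iota>) *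
       (\<Sum>\<alpha>'\<in>?A. \<Sum>\<iota>'\<in>?I. V a' \<alpha>' \<iota>' * G M1 M2 \<nu>' \<alpha>' \<iota>')))"
    by (rule sum_channels)
  finally show ?thesis
    by (simp only: R_def V_def G_def recoupling_pairs of_real_sum of_real_mult)
qed

definition acoef_nat :: "nat \<Rightarrow> nat \<Rightarrow> nat \<Rightarrow> nat \<Rightarrow> nat \<Rightarrow> real" where
  "acoef_nat L1 L2 L M1 M2 = (\<Sum>n1\<le>M1. \<Sum>n2\<le>M2. recoupling L1 L2 L M1 M2 n1 n2 0 * cg M1 M2 L n1 n2 0)"

text \<open>The triangle inequalities together with the parity condition, for doubled spins.\<close>

definition triangle :: "nat \<Rightarrow> nat \<Rightarrow> nat \<Rightarrow> bool" where
  "triangle L1 L2 L \<longleftrightarrow> (\<exists>A B N. L1 = A + N \<and> L2 = B + N \<and> L = A + B)"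

lemma triangleI:
  assumes "L \<le> L1 + L2" "L1 \<le> L + L2" "L2 \<le> L + L1" "even (L1 + L2 + L)"
  shows "triangle L1 L2 L"
proof -
  obtain k where k: "L1 + L2 + L = 2 * k" using assms(4) by blast
  show ?thesis unfolding triangle_def
    by (rule exI[of _ "k - L2"], rule exI[of _ "k - L1"], rule exI[of _ "k - L"]) (use assms(1-3) k in auto)
qed

lemma cg_eq_0:
  assumes "\<not> (\<bar>real L1 / 2 - real L2 / 2\<bar> \<le> real L / 2 \<and> real L / 2 \<le> real L1 / 2 + real L2 / 2)"
  shows "cg L1 L2 L a1 a2 a = 0"
  using assms by (auto simp: cg_def CG_def)

text \<open>The factor of proportionality is recovered by pairing with the unit vector of highest weight.\<close>

lemma acoef_nat_eq:
  assumes "triangle M1 M2 L"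
    and "\<forall>n1\<le>M1. \<forall>n2\<le>M2. \<forall>a\<le>L. recoupling L1 L2 L M1 M2 n1 n2 a = c * cg M1 M2 L n1 n2 a"
  shows "acoef_nat L1 L2 L M1 M2 = c"
proof -
  obtain A B N where M: "M1 = A + N" "M2 = B + N" "L = A + B" using assms(1) by (auto simp: triangle_def)
  have "acoef_nat L1 L2 L M1 M2 = (\<Sum>n1\<le>M1. \<Sum>n2\<le>M2. c * (cg M1 M2 L n1 n2 0)\<^sup>2)"
    unfolding acoef_nat_def using assms(2) by (intro sum.cong refl) (simp add: power2_eq_square)
  also have "\<dots> = c"
    using cg_top_weight_norm[of A N B] by (simp add: M sum_distrib_left [symmetric])
  finally show ?thesis .
qed

text \<open>If the triangle inequalities fail for \<open>(M1, M2, L)\<close>, the coefficients \<open>cg M1 M2 L\<close> vanish, and with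
  them the recoupling coefficients, which are multiples of them.\<close>

lemma spherical_mat_recurrence:
  assumes det: "det k1 = 1" "det k2 = 1" and tri: "triangle L1 L2 L" and a: "a \<le> L" "a' \<le> L"
  shows "spherical_mat 1 1 0 k1 k2 0 0 * spherical_mat L1 L2 L k1 k2 a' a =
    (\<Sum>M1\<in>half_spins L1. \<Sum>M2\<in>half_spins L2.
       if \<bar>real M1 / 2 - real M2 / 2\<bar> \<le> real L / 2 \<and> real L / 2 \<le> real M1 / 2 + real M2 / 2
       then of_real ((acoef_nat L1 L2 L M1 M2)\<^sup>2) * spherical_mat M1 M2 L k1 k2 a' a else 0)"
  unfolding spherical_mat_product[OF det]
proof (rule sum.cong[OF refl], rule sum.cong[OF refl])
  fix M1 M2 assume M: "M1 \<in> half_spins L1" "M2 \<in> half_spins L2"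
  obtain A B N where L: "L1 = A + N" "L2 = B + N" "L = A + B" using tri by (auto simp: triangle_def)
  obtain c where c: "\<forall>n1\<le>M1. \<forall>n2\<le>M2. \<forall>a\<le>L. recoupling L1 L2 L M1 M2 n1 n2 a = c * cg M1 M2 L n1 n2 a"
    using recoupling_proportional[OF L M] by blast
  have "(\<Sum>\<nu>\<in>{..M1} \<times> {..M2}. \<Sum>\<nu>'\<in>{..M1} \<times> {..M2}.
       (tmat k1 M1 (fst \<nu>') (fst \<nu>) * tmat k2 M2 (snd \<nu>') (snd \<nu>)) *
       (of_real (recoupling L1 L2 L M1 M2 (fst \<nu>) (snd \<nu>) a) * of_real (recoupling L1 L2 L M1 M2 (fst \<nu>') (snd \<nu>') a'))) =
     of_real (c\<^sup>2) * spherical_mat M1 M2 L k1 k2 a' a" (is "?s = _")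
    unfolding spherical_mat_def sum_distrib_left
    by (intro sum.cong refl) (use c a in \<open>auto simp: power2_eq_square\<close>)
  moreover have "c = acoef_nat L1 L2 L M1 M2" if "\<bar>real M1 / 2 - real M2 / 2\<bar> \<le> real L / 2 \<and> real L / 2 \<le> real M1 / 2 + real M2 / 2"
  proof -
    have "even (M1 + M2 + L)" using M by (auto simp: L half_spins_def split: if_splits)
    then have "triangle M1 M2 L" using that by (intro triangleI) linarith+
    then show ?thesis using acoef_nat_eq[OF _ c] by simp
  qed
  moreover have "spherical_mat M1 M2 L k1 k2 a' a = 0" if "\<not> (\<bar>real M1 / 2 - real M2 / 2\<bar> \<le> real L / 2 \<and> real L / 2 \<le> real M1 / 2 + real M2 / 2)"
    unfolding spherical_mat_def cg_eq_0[OF that] by simp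
  ultimately show "?s = (if \<bar>real M1 / 2 - real M2 / 2\<bar> \<le> real L / 2 \<and> real L / 2 \<le> real M1 / 2 + real M2 / 2
       then of_real ((acoef_nat L1 L2 L M1 M2)\<^sup>2) * spherical_mat M1 M2 L k1 k2 a' a else 0)"
    by auto
qed

lemma acoef_nat_top_nonzero:
  assumes "triangle L1 L2 L"
  shows "acoef_nat L1 L2 L (L1 + 1) (L2 + 1) \<noteq> 0"
proof -
  obtain A B N where L: "L1 = A + N" "L2 = B + N" "L = A + B" using assms by (auto simp: triangle_def)
  have "triangle (L1 + 1) (L2 + 1) L"
    unfolding triangle_def by (rule exI[of _ A], rule exI[of _ B], rule exI[of _ "N + 1"]) (simp add: L)
  then have "acoef_nat L1 L2 L (L1 + 1) (L2 + 1) = kappa A B N / sqrt 2 / kappa A B (N + 1)"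
    by (rule acoef_nat_eq) (use recoupling_raise_raise[of _ A N _ B] in \<open>simp add: L\<close>)
  then show ?thesis using kappa_pos[of A B N] kappa_pos[of A B "N + 1"] by simp
qed

section \<open>From operators on polynomials to matrices\<close>

text \<open>The element of \<open>Hspace (L/2)\<close> with coordinates \<open>c\<close>; \<open>expand2\<close> below is its analogue for the tensor
  product.\<close>

definition expand :: "nat \<Rightarrow> (nat \<Rightarrow> complex) \<Rightarrow> vec2 \<Rightarrow> complex" where
  "expand L c z = (\<Sum>a\<le>L. c a * pol L a (z $ 1) (z $ 2))"

definition expand2 :: "nat \<Rightarrow> nat \<Rightarrow> (nat \<Rightarrow> nat \<Rightarrow> complex) \<Rightarrow> vec2 \<times> vec2 \<Rightarrow> complex" where
  "expand2 L1 L2 c = (\<lambda>(z, w). \<Sum>a1\<le>L1. \<Sum>a2\<le>L2. c a1 a2 * (pol L1 a1 (z $ 1) (z $ 2) * pol L2 a2 (w $ 1) (w $ 2)))"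

definition cvec :: "complex \<Rightarrow> complex \<Rightarrow> vec2" where
  "cvec x y = (\<chi> i. if i = 1 then x else y)"

lemma cvec_nth [simp]: "cvec x y $ 1 = x" "cvec x y $ 2 = y"
  by (simp_all add: cvec_def)

lemma expand_eq_iff: "expand L c = expand L d \<longleftrightarrow> (\<forall>a\<le>L. c a = d a)"
proof
  assume eq: "expand L c = expand L d"
  have "(\<Sum>a\<le>L. c a * pol L a x y) = (\<Sum>a\<le>L. d a * pol L a x y)" for x y
    using fun_cong[OF eq, of "cvec x y"] by (simp add: expand_def)
  then show "\<forall>a\<le>L. c a = d a" using pol_eq_iff by blast
next
  assume "\<forall>a\<le>L. c a = d a"
  then show "expand L c = expand L d" by (auto simp: expand_def fun_eq_iff intro!: sum.cong)
qed

lemma expand2_eq_imp: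
  assumes "expand2 L1 L2 c = expand2 L1 L2 d" "a1 \<le> L1" "a2 \<le> L2"
  shows "c a1 a2 = d a1 a2"
proof (rule pol_eq_iff2[OF _ assms(2,3)])
  fix x y u v
  show "(\<Sum>a\<le>L1. \<Sum>b\<le>L2. c a b * (pol L1 a x y * pol L2 b u v)) = (\<Sum>a\<le>L1. \<Sum>b\<le>L2. d a b * (pol L1 a x y * pol L2 b u v))"
    using fun_cong[OF assms(1), of "(cvec x y, cvec u v)"] by (simp add: expand2_def)
qed

lemma Hspace_expand: "p \<in> Hspace (real L / 2) \<longleftrightarrow> (\<exists>c. p = expand L c)"
proof
  assume "p \<in> Hspace (real L / 2)"
  then obtain c where p: "p = (\<lambda>z. \<Sum>i\<le>L. c i * (z $ 1) ^ i * (z $ 2) ^ (L - i))"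
    by (auto simp: Hspace_def)
  have "homog L (\<lambda>x y. \<Sum>i\<le>L. c i * x ^ i * y ^ (L - i))" unfolding homog_monomials by blast
  then obtain d where "\<And>x y. (\<Sum>i\<le>L. c i * x ^ i * y ^ (L - i)) = (\<Sum>b\<le>L. d b * pol L b x y)"
    by (auto simp: homog_def)
  then have "p = expand L d" by (auto simp: p expand_def fun_eq_iff)
  then show "\<exists>c. p = expand L c" by blast
next
  assume "\<exists>c. p = expand L c"
  then obtain c where p: "p = expand L c" by blast
  have "homog L (\<lambda>x y. \<Sum>b\<le>L. c b * pol L b x y)" by (auto simp: homog_def)
  then obtain d where "\<And>x y. (\<Sum>b\<le>L. c b * pol L b x y) = (\<Sum>i\<le>L. d i * x ^ i * y ^ (L - i))"
    unfolding homog_monomials by blast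
  then show "p \<in> Hspace (real L / 2)" by (auto simp: p expand_def Hspace_def fun_eq_iff intro!: exI[of _ d])
qed

lemma expand_in_Hspace: "expand L c \<in> Hspace (real L / 2)"
  unfolding Hspace_expand by blast

lemma sum_psi: "(\<Sum>j\<in>steps (- (real L / 2)) (real L / 2). c j * psi (real L / 2) j z) = expand L (\<lambda>a. c (real L / 2 - real a)) z"
  unfolding sum_spin expand_def by (intro sum.cong refl) (simp add: psi_spin)

text \<open>Coordinates are chosen by Hilbert choice; one expansion of \<open>p\<close> suffices for the chosen one to be an
  expansion too.  Linear independence then identifies it.\<close>

lemma coord_expansion:
  "p = (\<lambda>x. \<Sum>i\<in>I. c i * e i x) \<Longrightarrow> p = (\<lambda>x. \<Sum>i\<in>I. coord I e p i * e i x)"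
  unfolding coord_def by (rule someI[where P = "\<lambda>c. p = (\<lambda>x. \<Sum>i\<in>I. c i * e i x)"])

lemma coordH_expand:
  assumes "a \<le> L"
  shows "coordH (real L / 2) (expand L c) (real L / 2 - real a) = c a"
proof -
  \<comment> \<open>The index is recovered from the weight \<open>j = L/2 - a\<close>.\<close>
  define c' where "c' j = c (nat \<lfloor>real L / 2 - j\<rfloor>)" for j
  have "expand L c = (\<lambda>z. \<Sum>j\<in>steps (- (real L / 2)) (real L / 2). c' j * psi (real L / 2) j z)"
    unfolding sum_psi by (simp add: c'_def)
  then have "expand L c = (\<lambda>z. \<Sum>j\<in>steps (- (real L / 2)) (real L / 2). coordH (real L / 2) (expand L c) j * psi (real L / 2) j z)"
    unfolding coordH_def by (rule coord_expansion)
  then have "expand L c = expand L (\<lambda>a. coordH (real L / 2) (expand L c) (real L / 2 - real a))"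
    unfolding sum_psi by (simp add: fun_eq_iff)
  then show ?thesis unfolding expand_eq_iff using assms by simp
qed

lemma sum_spin2:
  "(\<Sum>j\<in>steps (- (real L1 / 2)) (real L1 / 2) \<times> steps (- (real L2 / 2)) (real L2 / 2). f j) =
   (\<Sum>a1\<le>L1. \<Sum>a2\<le>L2. f (real L1 / 2 - real a1, real L2 / 2 - real a2))"
proof -
  have "(\<Sum>j\<in>A \<times> B. f j) = (\<Sum>j1\<in>A. \<Sum>j2\<in>B. f (j1, j2))" for A B
    by (simp add: sum_pair)
  then show ?thesis by (simp only: sum_spin)
qed

lemma sum_psi2: "(\<Sum>j\<in>steps (- (real L1 / 2)) (real L1 / 2) \<times> steps (- (real L2 / 2)) (real L2 / 2).
    c j * psi2 (real L1 / 2) (real L2 / 2) j x) =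
  expand2 L1 L2 (\<lambda>a1 a2. c (real L1 / 2 - real a1, real L2 / 2 - real a2)) x"
  unfolding sum_spin2 expand2_def
  by (cases x) (auto simp: psi2_def tensor_def psi_spin intro!: sum.cong)

lemma coordH2_expand2:
  assumes "a1 \<le> L1" "a2 \<le> L2"
  shows "coordH2 (real L1 / 2) (real L2 / 2) (expand2 L1 L2 c) (real L1 / 2 - real a1, real L2 / 2 - real a2) = c a1 a2"
proof -
  let ?I = "steps (- (real L1 / 2)) (real L1 / 2) \<times> steps (- (real L2 / 2)) (real L2 / 2)"
  define c' where "c' j = c (nat \<lfloor>real L1 / 2 - fst j\<rfloor>) (nat \<lfloor>real L2 / 2 - snd j\<rfloor>)" for j
  have "expand2 L1 L2 c = (\<lambda>x. \<Sum>j\<in>?I. c' j * psi2 (real L1 / 2) (real L2 / 2) j x)"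
    unfolding sum_psi2 by (simp add: c'_def)
  then have "expand2 L1 L2 c = (\<lambda>x. \<Sum>j\<in>?I. coordH2 (real L1 / 2) (real L2 / 2) (expand2 L1 L2 c) j * psi2 (real L1 / 2) (real L2 / 2) j x)"
    unfolding coordH2_def by (rule coord_expansion)
  then have "expand2 L1 L2 c = expand2 L1 L2 (\<lambda>a1 a2. coordH2 (real L1 / 2) (real L2 / 2) (expand2 L1 L2 c) (real L1 / 2 - real a1, real L2 / 2 - real a2))"
    unfolding sum_psi2 by (simp add: fun_eq_iff)
  from expand2_eq_imp[OF this assms] show ?thesis by simp
qed

lemma innerH_expand: "innerH (real L / 2) (expand L c) (expand L d) = (\<Sum>a\<le>L. c a * cnj (d a))"
  unfolding innerH_def basis_inner_def coordH_def [symmetric] sum_spin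
  by (intro sum.cong refl) (simp add: coordH_expand)

lemma innerH2_expand2:
  "innerH2 (real L1 / 2) (real L2 / 2) (expand2 L1 L2 c) (expand2 L1 L2 d) = (\<Sum>a1\<le>L1. \<Sum>a2\<le>L2. c a1 a2 * cnj (d a1 a2))"
  unfolding innerH2_def basis_inner_def coordH2_def [symmetric] sum_spin2
  by (intro sum.cong refl) (simp add: coordH2_expand2)

lemma beta_expand:
  "beta (real L1 / 2) (real L2 / 2) (real L / 2) (expand L c) =
   expand2 L1 L2 (\<lambda>a1 a2. \<Sum>a\<le>L. c a * of_real (cg L1 L2 L a1 a2 a))"
proof (rule ext)
  fix x :: "vec2 \<times> vec2"
  obtain z w where x: "x = (z, w)" by (cases x)
  have "beta (real L1 / 2) (real L2 / 2) (real L / 2) (expand L c) x =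
    (\<Sum>a\<le>L. \<Sum>a1\<le>L1. \<Sum>a2\<le>L2. c a * of_real (cg L1 L2 L a1 a2 a) * (pol L1 a1 (z $ 1) (z $ 2) * pol L2 a2 (w $ 1) (w $ 2)))"
    unfolding beta_def sum_spin sum_distrib_left
    by (intro sum.cong refl) (simp add: coordH_expand x tensor_def psi_spin cg_def)
  also have "\<dots> = (\<Sum>a1\<le>L1. \<Sum>a2\<le>L2. \<Sum>a\<le>L. c a * of_real (cg L1 L2 L a1 a2 a) * (pol L1 a1 (z $ 1) (z $ 2) * pol L2 a2 (w $ 1) (w $ 2)))"
    by (rule sum_pull2 [symmetric])
  also have "\<dots> = expand2 L1 L2 (\<lambda>a1 a2. \<Sum>a\<le>L. c a * of_real (cg L1 L2 L a1 a2 a)) x"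
    unfolding expand2_def x case_prod_conv sum_distrib_right ..
  finally show "beta (real L1 / 2) (real L2 / 2) (real L / 2) (expand L c) x = \<dots>" .
qed

lemma Trep_psi:
  assumes "a \<le> L"
  shows "Trep k (psi (real L / 2) (real L / 2 - real a)) z = (\<Sum>b\<le>L. tmat k L b a * pol L b (z $ 1) (z $ 2))"
  using tmat[OF assms, of k "z $ 1" "z $ 2"]
  by (simp add: Trep_def psi_spin assms matrix_vector_mult_def sum_2 transpose_def)

lemma Trep2_expand2:
  "Trep2 (real L1 / 2) (real L2 / 2) (k1, k2) (expand2 L1 L2 c) =
   expand2 L1 L2 (\<lambda>b1 b2. \<Sum>a1\<le>L1. \<Sum>a2\<le>L2. c a1 a2 * (tmat k1 L1 b1 a1 * tmat k2 L2 b2 a2))"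
proof (rule ext)
  fix x :: "vec2 \<times> vec2"
  obtain z w where x: "x = (z, w)" by (cases x)
  have "Trep2 (real L1 / 2) (real L2 / 2) (k1, k2) (expand2 L1 L2 c) x =
    (\<Sum>a1\<le>L1. \<Sum>a2\<le>L2. c a1 a2 * ((\<Sum>b1\<le>L1. tmat k1 L1 b1 a1 * pol L1 b1 (z $ 1) (z $ 2)) *
       (\<Sum>b2\<le>L2. tmat k2 L2 b2 a2 * pol L2 b2 (w $ 1) (w $ 2))))"
    unfolding Trep2_def sum_spin case_prod_conv
    by (intro sum.cong refl) (simp add: coordH2_expand2 x tensor_def Trep_psi)
  also have "\<dots> = (\<Sum>a1\<le>L1. \<Sum>a2\<le>L2. \<Sum>b1\<le>L1. \<Sum>b2\<le>L2. c a1 a2 * ((tmat k1 L1 b1 a1 * pol L1 b1 (z $ 1) (z $ 2)) *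
       (tmat k2 L2 b2 a2 * pol L2 b2 (w $ 1) (w $ 2))))"
    by (simp only: sum_distrib_left [symmetric] sum_distrib_right [symmetric])
  also have "\<dots> = (\<Sum>b1\<le>L1. \<Sum>b2\<le>L2. \<Sum>a1\<le>L1. \<Sum>a2\<le>L2. c a1 a2 * ((tmat k1 L1 b1 a1 * pol L1 b1 (z $ 1) (z $ 2)) *
       (tmat k2 L2 b2 a2 * pol L2 b2 (w $ 1) (w $ 2))))"
    by (rule sum_swap_pairs)
  also have "\<dots> = expand2 L1 L2 (\<lambda>b1 b2. \<Sum>a1\<le>L1. \<Sum>a2\<le>L2. c a1 a2 * (tmat k1 L1 b1 a1 * tmat k2 L2 b2 a2)) x"
    unfolding expand2_def x case_prod_conv sum_distrib_right by (simp only: mult_ac)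
  finally show "Trep2 (real L1 / 2) (real L2 / 2) (k1, k2) (expand2 L1 L2 c) x = \<dots>" .
qed

lemma expand2_in_Hspace2: "expand2 L1 L2 d \<in> Hspace2 (real L1 / 2) (real L2 / 2)"
proof -
  have "(\<forall>i<Suc L1. expand L1 (\<lambda>a. if a = i then 1 else 0) \<in> Hspace (real L1 / 2) \<and> expand L2 (d i) \<in> Hspace (real L2 / 2)) \<and>
    expand2 L1 L2 d = (\<lambda>x. \<Sum>i<Suc L1. (expand L1 (\<lambda>a. if a = i then 1 else 0) \<otimes>\<^sub>f expand L2 (d i)) x)"
  proof (intro conjI)
    show "expand2 L1 L2 d = (\<lambda>x. \<Sum>i<Suc L1. (expand L1 (\<lambda>a. if a = i then 1 else 0) \<otimes>\<^sub>f expand L2 (d i)) x)"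
    proof (rule ext)
      fix x :: "vec2 \<times> vec2"
      obtain z w where x: "x = (z, w)" by (cases x)
      have e: "expand L1 (\<lambda>a. if a = i then 1 else 0) z = pol L1 i (z $ 1) (z $ 2)" if "i \<le> L1" for i
        using that unfolding expand_def by (rule sum_indicator_mult)
      show "expand2 L1 L2 d x = (\<Sum>i<Suc L1. (expand L1 (\<lambda>a. if a = i then 1 else 0) \<otimes>\<^sub>f expand L2 (d i)) x)"
        unfolding lessThan_Suc_atMost expand2_def x tensor_def case_prod_conv
        by (intro sum.cong refl) (simp add: e, simp add: expand_def sum_distrib_left mult_ac)
    qed
  qed (simp_all add: expand_in_Hspace)
  then show ?thesis
    unfolding Hspace2_def mem_Collect_eq
    by (intro exI[of _ "Suc L1"] exI[of _ "\<lambda>i. expand L1 (\<lambda>a. if a = i then 1 else 0)"]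
        exI[of _ "\<lambda>i. expand L2 (d i)"])
qed

text \<open>The coupling coefficients are real, so the adjoint has the transposed matrix.  Uniqueness follows by
  testing against the basis vectors.\<close>

lemma beta_adj_expand2:
  "beta_adj (real L1 / 2) (real L2 / 2) (real L / 2) (expand2 L1 L2 d) =
   expand L (\<lambda>a. \<Sum>a1\<le>L1. \<Sum>a2\<le>L2. of_real (cg L1 L2 L a1 a2 a) * d a1 a2)"
proof -
  let ?q = "\<lambda>a. \<Sum>a1\<le>L1. \<Sum>a2\<le>L2. of_real (cg L1 L2 L a1 a2 a) * d a1 a2"
  have adj: "innerH2 (real L1 / 2) (real L2 / 2) (beta (real L1 / 2) (real L2 / 2) (real L / 2) (expand L c)) (expand2 L1 L2 d) =
     (\<Sum>a\<le>L. c a * cnj (?q a))" for c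
  proof -
    have "innerH2 (real L1 / 2) (real L2 / 2) (beta (real L1 / 2) (real L2 / 2) (real L / 2) (expand L c)) (expand2 L1 L2 d) =
       (\<Sum>a1\<le>L1. \<Sum>a2\<le>L2. \<Sum>a\<le>L. c a * (of_real (cg L1 L2 L a1 a2 a) * cnj (d a1 a2)))"
      unfolding beta_expand innerH2_expand2 by (simp add: sum_distrib_right mult.assoc)
    also have "\<dots> = (\<Sum>a\<le>L. \<Sum>a1\<le>L1. \<Sum>a2\<le>L2. c a * (of_real (cg L1 L2 L a1 a2 a) * cnj (d a1 a2)))"
      by (rule sum_pull2)
    finally show ?thesis by (simp add: sum_distrib_left)
  qed
  have "(THE q. q \<in> Hspace (real L / 2) \<and> (\<forall>p\<in>Hspace (real L / 2).
     innerH2 (real L1 / 2) (real L2 / 2) (beta (real L1 / 2) (real L2 / 2) (real L / 2) p) (expand2 L1 L2 d) =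
     innerH (real L / 2) p q)) = expand L ?q"
  proof (rule the_equality)
    show "expand L ?q \<in> Hspace (real L / 2) \<and> (\<forall>p\<in>Hspace (real L / 2).
       innerH2 (real L1 / 2) (real L2 / 2) (beta (real L1 / 2) (real L2 / 2) (real L / 2) p) (expand2 L1 L2 d) =
       innerH (real L / 2) p (expand L ?q))"
    proof (intro conjI ballI)
      fix p assume "p \<in> Hspace (real L / 2)"
      then obtain c where "p = expand L c" unfolding Hspace_expand by blast
      then show "innerH2 (real L1 / 2) (real L2 / 2) (beta (real L1 / 2) (real L2 / 2) (real L / 2) p) (expand2 L1 L2 d) =
        innerH (real L / 2) p (expand L ?q)" by (simp only: adj innerH_expand)
    qed (simp_all add: expand_in_Hspace)
  next
    fix q assume q: "q \<in> Hspace (real L / 2) \<and> (\<forall>p\<in>Hspace (real L / 2).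
       innerH2 (real L1 / 2) (real L2 / 2) (beta (real L1 / 2) (real L2 / 2) (real L / 2) p) (expand2 L1 L2 d) =
       innerH (real L / 2) p q)"
    then obtain e where e: "q = expand L e" unfolding Hspace_expand by blast
    have "e a = ?q a" if "a \<le> L" for a
    proof -
      \<comment> \<open>Testing against the basis vector \<open>a\<close> extracts the coordinate of \<open>q\<close> there.\<close>
      let ?d = "\<lambda>b. if b = a then 1 else 0 :: complex"
      from q expand_in_Hspace have "innerH2 (real L1 / 2) (real L2 / 2) (beta (real L1 / 2) (real L2 / 2) (real L / 2) (expand L ?d)) (expand2 L1 L2 d) =
         innerH (real L / 2) (expand L ?d) (expand L e)"
        unfolding e by blast
      then have "(\<Sum>b\<le>L. ?d b * cnj (?q b)) = (\<Sum>b\<le>L. ?d b * cnj (e b))"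
        unfolding adj innerH_expand .
      moreover have "(\<Sum>b\<le>L. ?d b * f b) = f a" for f :: "nat \<Rightarrow> complex"
        using that by (rule sum_indicator_mult)
      ultimately have "cnj (?q a) = cnj (e a)" by (simp only:)
      then show ?thesis by (simp only: complex_cnj_cancel_iff)
    qed
    then show "q = expand L ?q" unfolding e expand_eq_iff by blast
  qed
  then show ?thesis unfolding beta_adj_def using expand2_in_Hspace2 by simp
qed

lemma Phi_expand:
  "Phi (real L / 2) (real L1 / 2) (real L2 / 2) (k1, k2) (expand L c) =
   expand L (\<lambda>a'. \<Sum>a\<le>L. c a * spherical_mat L1 L2 L k1 k2 a' a)"
proof -
  have "(\<Sum>b1\<le>L1. \<Sum>b2\<le>L2. of_real (cg L1 L2 L b1 b2 a') * (\<Sum>a1\<le>L1. \<Sum>a2\<le>L2.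
       (\<Sum>a\<le>L. c a * of_real (cg L1 L2 L a1 a2 a)) * (tmat k1 L1 b1 a1 * tmat k2 L2 b2 a2))) =
     (\<Sum>a\<le>L. c a * spherical_mat L1 L2 L k1 k2 a' a)" for a'
  proof -
    have "(\<Sum>b1\<le>L1. \<Sum>b2\<le>L2. of_real (cg L1 L2 L b1 b2 a') * (\<Sum>a1\<le>L1. \<Sum>a2\<le>L2.
       (\<Sum>a\<le>L. c a * of_real (cg L1 L2 L a1 a2 a)) * (tmat k1 L1 b1 a1 * tmat k2 L2 b2 a2))) =
       (\<Sum>b1\<le>L1. \<Sum>b2\<le>L2. \<Sum>a1\<le>L1. \<Sum>a2\<le>L2. \<Sum>a\<le>L. c a * (of_real (cg L1 L2 L a1 a2 a * cg L1 L2 L b1 b2 a') *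
         (tmat k1 L1 b1 a1 * tmat k2 L2 b2 a2)))"
      unfolding sum_distrib_left sum_distrib_right by (intro sum.cong refl) simp
    also have "\<dots> = (\<Sum>b1\<le>L1. \<Sum>b2\<le>L2. \<Sum>a\<le>L. \<Sum>a1\<le>L1. \<Sum>a2\<le>L2. c a * (of_real (cg L1 L2 L a1 a2 a * cg L1 L2 L b1 b2 a') *
         (tmat k1 L1 b1 a1 * tmat k2 L2 b2 a2)))"
      by (rule sum.cong[OF refl], rule sum.cong[OF refl], rule sum_pull2)
    also have "\<dots> = (\<Sum>a\<le>L. \<Sum>b1\<le>L1. \<Sum>b2\<le>L2. \<Sum>a1\<le>L1. \<Sum>a2\<le>L2. c a * (of_real (cg L1 L2 L a1 a2 a * cg L1 L2 L b1 b2 a') *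
         (tmat k1 L1 b1 a1 * tmat k2 L2 b2 a2)))"
      by (rule sum_pull2)
    also have "\<dots> = (\<Sum>a\<le>L. c a * (\<Sum>a1\<le>L1. \<Sum>a2\<le>L2. \<Sum>b1\<le>L1. \<Sum>b2\<le>L2. of_real (cg L1 L2 L a1 a2 a * cg L1 L2 L b1 b2 a') *
         (tmat k1 L1 b1 a1 * tmat k2 L2 b2 a2)))"
      by (rule sum.cong[OF refl], subst sum_swap_pairs) (simp only: sum_distrib_left)
    also have "\<dots> = (\<Sum>a\<le>L. c a * spherical_mat L1 L2 L k1 k2 a' a)"
      unfolding spherical_mat_def sum_pairs ..
    finally show ?thesis .
  qed
  then show ?thesis unfolding Phi_def by (simp add: beta_expand Trep2_expand2 beta_adj_expand2)
qed

lemma phi_spherical_mat: "phi (k1, k2) = spherical_mat 1 1 0 k1 k2 0 0"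
proof -
  have P: "Phi 0 (1 / 2) (1 / 2) (k1, k2) (expand 0 c) = expand 0 (\<lambda>_. c 0 * spherical_mat 1 1 0 k1 k2 0 0)" for c
    using Phi_expand[of 0 1 1 k1 k2 c] by (simp add: expand_eq_iff)
  have H: "p \<in> Hspace 0 \<longleftrightarrow> (\<exists>c. p = expand 0 c)" for p using Hspace_expand[of p 0] by simp
  have l: "expand 0 c z = c 0" for c z by (simp add: expand_def pol_def)
  show ?thesis unfolding phi_def scalar0_def
  proof (rule the_equality)
    show "\<forall>p\<in>Hspace 0. Phi 0 (1 / 2) (1 / 2) (k1, k2) p = (\<lambda>z. spherical_mat 1 1 0 k1 k2 0 0 * p z)"
    proof
      fix p assume "p \<in> Hspace 0"
      then obtain c where "p = expand 0 c" unfolding H by blast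
      then show "Phi 0 (1 / 2) (1 / 2) (k1, k2) p = (\<lambda>z. spherical_mat 1 1 0 k1 k2 0 0 * p z)"
        by (simp only: P) (simp add: l fun_eq_iff)
    qed
  next
    fix c assume "\<forall>p\<in>Hspace 0. Phi 0 (1 / 2) (1 / 2) (k1, k2) p = (\<lambda>z. c * p z)"
    moreover have "expand 0 (\<lambda>_. 1) \<in> Hspace 0" unfolding H by blast
    ultimately have "Phi 0 (1 / 2) (1 / 2) (k1, k2) (expand 0 (\<lambda>_. 1)) = (\<lambda>z. c * expand 0 (\<lambda>_. 1) z)"
      by blast
    then show "c = spherical_mat 1 1 0 k1 k2 0 0" unfolding P by (simp add: l fun_eq_iff)
  qed
qed

lemma acoef_acoef_nat: "acoef (real L1 / 2) (real L2 / 2) (real M1 / 2) (real M2 / 2) (real L / 2) = acoef_nat L1 L2 L M1 M2"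
proof -
  have half: "steps (- (1 / 2)) (1 / 2) = steps (- (real 1 / 2)) (real 1 / 2)" by simp
  have "acoef (real L1 / 2) (real L2 / 2) (real M1 / 2) (real M2 / 2) (real L / 2) =
    (\<Sum>a1\<le>L1. \<Sum>a2\<le>L2. \<Sum>i1\<le>1. \<Sum>i2\<le>1. \<Sum>n1\<le>M1. \<Sum>n2\<le>M2.
       cg L1 L2 L a1 a2 0 * cg 1 1 0 i1 i2 0 * cg L1 1 M1 a1 i1 n1 * cg L2 1 M2 a2 i2 n2 * cg M1 M2 L n1 n2 0)"
    unfolding acoef_def half sum_spin by (simp only: cg_def of_nat_0 of_nat_1 diff_zero div_0)
  also have "\<dots> = (\<Sum>a1\<le>L1. \<Sum>a2\<le>L2. \<Sum>n1\<le>M1. \<Sum>n2\<le>M2. \<Sum>i1\<le>1. \<Sum>i2\<le>1.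
       cg L1 L2 L a1 a2 0 * cg 1 1 0 i1 i2 0 * cg L1 1 M1 a1 i1 n1 * cg L2 1 M2 a2 i2 n2 * cg M1 M2 L n1 n2 0)"
    by (rule sum.cong[OF refl], rule sum.cong[OF refl], rule sum_swap_pairs)
  also have "\<dots> = (\<Sum>n1\<le>M1. \<Sum>n2\<le>M2. \<Sum>a1\<le>L1. \<Sum>a2\<le>L2. \<Sum>i1\<le>1. \<Sum>i2\<le>1.
       cg L1 L2 L a1 a2 0 * cg 1 1 0 i1 i2 0 * cg L1 1 M1 a1 i1 n1 * cg L2 1 M2 a2 i2 n2 * cg M1 M2 L n1 n2 0)"
    by (rule sum_swap_pairs)
  also have "\<dots> = acoef_nat L1 L2 L M1 M2"
    by (simp only: acoef_nat_def recoupling_def sum_distrib_right)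
  finally show ?thesis .
qed

lemma sum_half_spins:
  "(\<Sum>m\<in>steps \<bar>real L / 2 - 1/2\<bar> (real L / 2 + 1/2). f m) = (\<Sum>M\<in>half_spins L. f (real M / 2))"
proof -
  have st: "steps a (a + real k) = (\<lambda>n. a + real n) ` {..k}" for a k by (auto simp: steps_def)
  have "steps \<bar>real L / 2 - 1/2\<bar> (real L / 2 + 1/2) = (\<lambda>M. real M / 2) ` half_spins L"
  proof (cases L)
    case 0
    then show ?thesis using st[of "1/2" 0] by (simp add: half_spins_def)
  next
    case (Suc A)
    have "\<bar>real L / 2 - 1/2\<bar> = real A / 2" "real L / 2 + 1/2 = real A / 2 + real 1"
      by (auto simp: Suc add_divide_distrib)
    moreover have "steps (real A / 2) (real A / 2 + real 1) = {real A / 2, real A / 2 + 1}"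
      unfolding st by (auto simp: atMost_Suc)
    ultimately show ?thesis by (simp add: Suc half_spins_def add_divide_distrib add_ac)
  qed
  then show ?thesis by (simp add: sum.reindex inj_on_def)
qed

theorem proposition3p1:
  fixes l l1 l2 :: real
  assumes "l \<in> half_nats" and "l1 \<in> half_nats" and "l2 \<in> half_nats"
    and "\<bar>l1 - l2\<bar> \<le> l" and "l \<le> l1 + l2" and "l1 + l2 - l \<in> \<int>"
  shows "(\<forall>x \<in> SU2 \<times> SU2. \<forall>p \<in> Hspace l.
      (\<lambda>z. phi x * Phi l l1 l2 x p z) =
      (\<lambda>z. \<Sum>m1\<in>steps \<bar>l1 - 1/2\<bar> (l1 + 1/2). \<Sum>m2\<in>steps \<bar>l2 - 1/2\<bar> (l2 + 1/2).
         if \<bar>m1 - m2\<bar> \<le> l \<and> l \<le> m1 + m2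
         then complex_of_real (\<bar>acoef l1 l2 m1 m2 l\<bar>\<^sup>2) * Phi l m1 m2 x p z
         else 0))
    \<and> acoef l1 l2 (l1 + 1/2) (l2 + 1/2) l \<noteq> 0"
proof -
  obtain L L1 L2 where L: "l = real L / 2" "l1 = real L1 / 2" "l2 = real L2 / 2"
    using assms(1-3) by (auto simp: half_nats_def)
  have tri: "triangle L1 L2 L"
  proof (rule triangleI)
    show "L \<le> L1 + L2" "L1 \<le> L + L2" "L2 \<le> L + L1" using assms(4,5) unfolding L by linarith+
    obtain k where "l1 + l2 - l = of_int k" using assms(6) by (auto elim: Ints_cases)
    then have "real_of_int (int L1 + int L2 - int L) = real_of_int (2 * k)" unfolding L by simp
    then have "int L1 + int L2 - int L = 2 * k" by (simp only: of_int_eq_iff)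
    then have "even (int (L1 + L2 + L))" by presburger
    then show "even (L1 + L2 + L)" by (simp only: even_of_nat)
  qed
  show ?thesis
  proof (intro conjI ballI)
    fix x p assume x: "x \<in> SU2 \<times> SU2" and p: "p \<in> Hspace l"
    obtain k1 k2 where k: "x = (k1, k2)" "det k1 = 1" "det k2 = 1" using x by (auto simp: SU2_def)
    obtain c where c: "p = expand L c" using p unfolding L Hspace_expand by blast
    let ?adm = "\<lambda>M1 M2. \<bar>real M1 / 2 - real M2 / 2\<bar> \<le> real L / 2 \<and> real L / 2 \<le> real M1 / 2 + real M2 / 2"
    show "(\<lambda>z. phi x * Phi l l1 l2 x p z) =
      (\<lambda>z. \<Sum>m1\<in>steps \<bar>l1 - 1/2\<bar> (l1 + 1/2). \<Sum>m2\<in>steps \<bar>l2 - 1/2\<bar> (l2 + 1/2).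
         if \<bar>m1 - m2\<bar> \<le> l \<and> l \<le> m1 + m2
         then complex_of_real (\<bar>acoef l1 l2 m1 m2 l\<bar>\<^sup>2) * Phi l m1 m2 x p z
         else 0)"
    proof (rule ext)
      fix z :: vec2
      let ?e = "\<lambda>a' a. c a * pol L a' (z $ 1) (z $ 2)"
      have Phi: "Phi l (real M1 / 2) (real M2 / 2) x p z = (\<Sum>a'\<le>L. \<Sum>a\<le>L. ?e a' a * spherical_mat M1 M2 L k1 k2 a' a)" for M1 M2
        unfolding L k c Phi_expand expand_def sum_distrib_right by (simp only: mult_ac)
      have "phi x * Phi l l1 l2 x p z = (\<Sum>a'\<le>L. \<Sum>a\<le>L. ?e a' a * (spherical_mat 1 1 0 k1 k2 0 0 * spherical_mat L1 L2 L k1 k2 a' a))"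
        unfolding L(2,3) Phi unfolding k phi_spherical_mat sum_distrib_left by (simp only: mult_ac)
      also have "\<dots> = (\<Sum>a'\<le>L. \<Sum>a\<le>L. \<Sum>M1\<in>half_spins L1. \<Sum>M2\<in>half_spins L2.
         if ?adm M1 M2 then of_real ((acoef_nat L1 L2 L M1 M2)\<^sup>2) * (?e a' a * spherical_mat M1 M2 L k1 k2 a' a) else 0)"
      proof (rule sum.cong[OF refl], rule sum.cong[OF refl])
        fix a' a assume "a' \<in> {..L}" "a \<in> {..L}"
        then have eq: "spherical_mat 1 1 0 k1 k2 0 0 * spherical_mat L1 L2 L k1 k2 a' a =
          (\<Sum>M1\<in>half_spins L1. \<Sum>M2\<in>half_spins L2.
             if ?adm M1 M2 then of_real ((acoef_nat L1 L2 L M1 M2)\<^sup>2) * spherical_mat M1 M2 L k1 k2 a' a else 0)"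
          by (intro spherical_mat_recurrence k tri) auto
        show "?e a' a * (spherical_mat 1 1 0 k1 k2 0 0 * spherical_mat L1 L2 L k1 k2 a' a) =
          (\<Sum>M1\<in>half_spins L1. \<Sum>M2\<in>half_spins L2.
         if ?adm M1 M2 then of_real ((acoef_nat L1 L2 L M1 M2)\<^sup>2) * (?e a' a * spherical_mat M1 M2 L k1 k2 a' a) else 0)"
          unfolding eq sum_distrib_left by (intro sum.cong refl) (simp add: mult_ac)
      qed
      also have "\<dots> = (\<Sum>M1\<in>half_spins L1. \<Sum>M2\<in>half_spins L2. \<Sum>a'\<le>L. \<Sum>a\<le>L.
         if ?adm M1 M2 then of_real ((acoef_nat L1 L2 L M1 M2)\<^sup>2) * (?e a' a * spherical_mat M1 M2 L k1 k2 a' a) else 0)"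
        by (rule sum_swap_pairs)
      also have "\<dots> = (\<Sum>M1\<in>half_spins L1. \<Sum>M2\<in>half_spins L2.
         if ?adm M1 M2 then of_real ((acoef_nat L1 L2 L M1 M2)\<^sup>2) * Phi l (real M1 / 2) (real M2 / 2) x p z else 0)"
        unfolding Phi sum_distrib_left by (intro sum.cong refl) auto
      also have "\<dots> = (\<Sum>m1\<in>steps \<bar>l1 - 1/2\<bar> (l1 + 1/2). \<Sum>m2\<in>steps \<bar>l2 - 1/2\<bar> (l2 + 1/2).
         if \<bar>m1 - m2\<bar> \<le> l \<and> l \<le> m1 + m2
         then complex_of_real (\<bar>acoef l1 l2 m1 m2 l\<bar>\<^sup>2) * Phi l m1 m2 x p z
         else 0)"
        unfolding L(2,3) sum_half_spins unfolding L(1) acoef_acoef_nat power2_abs ..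
      finally show "phi x * Phi l l1 l2 x p z = \<dots>" .
    qed
  next
    have h: "l1 + 1/2 = real (L1 + 1) / 2" "l2 + 1/2 = real (L2 + 1) / 2" by (simp_all add: L)
    show "acoef l1 l2 (l1 + 1/2) (l2 + 1/2) l \<noteq> 0"
      unfolding h unfolding L acoef_acoef_nat by (rule acoef_nat_top_nonzero[OF tri])
  qed
qed

end
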